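(* Let $p$ be prime, $1\le k<p$, and let $H$ be a Sylow $p$-subgroup of $S_{pk}$. Define $T:S_{pk}\to\{k,\dots,2k\}$ by $$T(\sigma)=a\iff |H\sigma H|=p^a.$$ Then the Sylow--Burnside kernel $P$ lumps under $T$, and the lumped transition kernel is given by $$\overline P(a,b)=\sum_{y=0}^{2k-\max\{a,b\}}\binom{2k-a}{y}\left(\frac{p-1}{p}\right)^y\frac{p^{a+b-2k}}{(p(k-y))!}\,f(b-y;k-y),$$ where $f(a;k)$ is the number of Sylow $p$-double cosets in $S_{pk}$ of size $p^a$. Furthermore, if $Z=\sum_{a=k}^{2k}f(a;k)$ is the total number of Sylow $p$-double cosets in $S_{pk}$, then the lumped stationary distribution is given by $$\overline\pi(a)=\frac{f(a;k)}{Z}.$$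
   Context: A Sylow $p$-double coset in $S_n$ is a set $H\sigma H$, $\sigma\in S_n$, with $H$ a (fixed) Sylow $p$-subgroup of $S_n$; thus for $0\le k'\le k$, $f(a';k')$ is the number of double cosets of size $p^{a'}$ in $S_{pk'}$ of a Sylow $p$-subgroup of $S_{pk'}$ (with $S_0$ the trivial group, so $f(0;0)=1$). In $S_{pk}$ with $k<p$ these sizes lie in $\{p^k,\dots,p^{2k}\}$. The group $H\times H$ acts on $S_{pk}$ by $\sigma^{h,g}=h^{-1}\sigma g$. Let $(H\times H)_\sigma=\{(h,g):\sigma^{h,g}=\sigma\}$ and $S_{pk}^{h,g}=\{\tau\in S_{pk}:\tau^{h,g}=\tau\}$. The Sylow--Burnside process is the Markov chain on $S_{pk}$ with transition kernel $$P(\sigma,\tau)=\frac{1}{|(H\times H)_\sigma|}\sum_{(h,g)\in (H\times H)_\sigma\cap(H\times H)_\tau}\frac{1}{|S_{pk}^{h,g}|}.$$ Its unique stationary distribution is $\pi(\sigma)=\frac{1}{Z|H\sigma H|}$. A transition kernel $P$ on $\mathcal X$ lumps under $T:\mathcal X\to\mathcal Y$ if for every Markov chain $(X_t)_{t\ge0}$ generated by $P$ (any initial distribution) the process $Y_t=T(X_t)$ is a Markov chain on $\mathcal Y$; the transition kernel of $(Y_t)$ is the lumped kernel $\overline P$, so that $\overline P(a,b)=P_\sigma(\{\tau:T(\tau)=b\})$ for every $\sigma$ with $T(\sigma)=a$, where $P_\sigma=P(\sigma,\cdot)$. The lumped stationary distribution is $\overline\pi(a)=\pi(\{\sigma:T(\sigma)=a\})$.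 *)

theory Defs
  imports "HOL-Probability.Probability" "HOL-Algebra.Sym_Groups" "HOL-Algebra.Group_Action"
begin

section \<open>Markov chains and lumping on finite state spaces\<close>

text \<open>State spaces are carrier sets, and kernels are only meaningful there. Since the sum of a
  real function over an infinite set is 0, a nonempty state space of a kernel is finite.\<close>

definition transition_kernel :: "'a set \<Rightarrow> ('a \<Rightarrow> 'a \<Rightarrow> real) \<Rightarrow> bool" where
  "transition_kernel S P \<longleftrightarrow> (\<forall>x\<in>S. (\<forall>y\<in>S. 0 \<le> P x y) \<and> (\<Sum>y\<in>S. P x y) = 1)"

text \<open>The initial distribution, i.e. the law of \<open>X 0\<close>, is unconstrained.\<close>

definition markov_chain ::
  "'w measure \<Rightarrow> 'a set \<Rightarrow> ('a \<Rightarrow> 'a \<Rightarrow> real) \<Rightarrow> (nat \<Rightarrow> 'w \<Rightarrow> 'a) \<Rightarrow> bool" where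
  "markov_chain M S P X \<longleftrightarrow>
     prob_space M \<and> transition_kernel S P \<and>
     (\<forall>t. X t \<in> measurable M (count_space S)) \<and>
     (\<forall>t x. (\<forall>i\<le>Suc t. x i \<in> S) \<and> \<P>(\<omega> in M. \<forall>i\<le>t. X i \<omega> = x i) \<noteq> 0 \<longrightarrow>
        \<P>(\<omega> in M. X (Suc t) \<omega> = x (Suc t) \<bar> \<forall>i\<le>t. X i \<omega> = x i) = P (x t) (x (Suc t)))"

text \<open>HOL cannot quantify over types inside a formula, so the type of the sample spaces is passed
  as the argument \<open>TYPE('w)\<close>; a theorem about these predicates with \<open>'w\<close> a free type variable
  covers the chains on all probability spaces.

  In \<open>lumps\<close> the kernel of the image process may a priori depend on the chain \<open>X\<close>;
  \<open>is_lumped_kernel\<close> says that one kernel \<open>Q\<close> serves all chains.\<close>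

definition lumps ::
  "'w itself \<Rightarrow> 'a set \<Rightarrow> ('a \<Rightarrow> 'a \<Rightarrow> real) \<Rightarrow> ('a \<Rightarrow> 'b) \<Rightarrow> 'b set \<Rightarrow> bool" where
  "lumps _ S P T Y \<longleftrightarrow>
     transition_kernel S P \<and> T \<in> S \<rightarrow> Y \<and>
     (\<forall>(M :: 'w measure) X. markov_chain M S P X \<longrightarrow>
        (\<exists>Q. markov_chain M Y Q (\<lambda>t \<omega>. T (X t \<omega>))))"

definition is_lumped_kernel ::
  "'w itself \<Rightarrow> 'a set \<Rightarrow> ('a \<Rightarrow> 'a \<Rightarrow> real) \<Rightarrow> ('a \<Rightarrow> 'b) \<Rightarrow> 'b set \<Rightarrow> ('b \<Rightarrow> 'b \<Rightarrow> real) \<Rightarrow> bool"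
  where
  "is_lumped_kernel _ S P T Y Q \<longleftrightarrow>
     transition_kernel Y Q \<and>
     (\<forall>(M :: 'w measure) X. markov_chain M S P X \<longrightarrow> markov_chain M Y Q (\<lambda>t \<omega>. T (X t \<omega>)))"

definition stationary_distribution :: "'a set \<Rightarrow> ('a \<Rightarrow> 'a \<Rightarrow> real) \<Rightarrow> ('a \<Rightarrow> real) \<Rightarrow> bool" where
  "stationary_distribution S P \<pi> \<longleftrightarrow>
     (\<forall>x\<in>S. 0 \<le> \<pi> x) \<and> (\<Sum>x\<in>S. \<pi> x) = 1 \<and> (\<forall>y\<in>S. (\<Sum>x\<in>S. \<pi> x * P x y) = \<pi> y)"

text \<open>The mass that \<open>\<mu>\<close> gives to the fibre of \<open>T\<close> over \<open>b\<close>; both \<open>P\<^sub>\<sigma>(T = b)\<close> and the lumped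
  stationary distribution have this form.\<close>

definition fibre_mass :: "'a set \<Rightarrow> ('a \<Rightarrow> 'b) \<Rightarrow> ('a \<Rightarrow> real) \<Rightarrow> 'b \<Rightarrow> real" where
  "fibre_mass S T \<mu> b = (\<Sum>x\<in>{x\<in>S. T x = b}. \<mu> x)"

section \<open>Sylow double cosets and the Sylow--Burnside kernel\<close>

definition sylow_subgroup :: "nat \<Rightarrow> 'a set \<Rightarrow> ('a, 'm) monoid_scheme \<Rightarrow> bool" where
  "sylow_subgroup p H G \<longleftrightarrow> subgroup H G \<and> card H = p ^ multiplicity p (order G)"

definition double_coset :: "('a, 'm) monoid_scheme \<Rightarrow> 'a set \<Rightarrow> 'a \<Rightarrow> 'a set" where
  "double_coset G H x = (H #>\<^bsub>G\<^esub> x) <#>\<^bsub>G\<^esub> H"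

definition double_cosets :: "('a, 'm) monoid_scheme \<Rightarrow> 'a set \<Rightarrow> 'a set set" where
  "double_cosets G H = double_coset G H ` carrier G"

text \<open>The exponent \<open>a\<close> with \<open>|H x H| = p ^ a\<close>.\<close>

definition double_coset_exponent :: "nat \<Rightarrow> ('a, 'm) monoid_scheme \<Rightarrow> 'a set \<Rightarrow> 'a \<Rightarrow> nat" where
  "double_coset_exponent p G H x = (THE a. card (double_coset G H x) = p ^ a)"

text \<open>\<open>sylow_double_coset_count p a k\<close> is \<open>f(a;k)\<close>. The choice of the Sylow subgroup
  is immaterial, because any two of them are conjugate.\<close>

definition sylow_double_coset_count :: "nat \<Rightarrow> nat \<Rightarrow> nat \<Rightarrow> nat" where
  "sylow_double_coset_count p a k =
     (let G = sym_group (p * k); H = (SOME H. sylow_subgroup p H G)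
      in card {D \<in> double_cosets G H. card D = p ^ a})"

text \<open>The action of \<open>H \<times> H\<close> on \<open>G\<close> is a right action, whereas \<open>group_action\<close> is about left
  actions; the sets \<open>stabilizer\<close> and \<open>invariants\<close> are defined for arbitrary families of maps.\<close>

definition twist :: "('a, 'm) monoid_scheme \<Rightarrow> 'a \<times> 'a \<Rightarrow> 'a \<Rightarrow> 'a" where
  "twist G = (\<lambda>(h, g) x. inv\<^bsub>G\<^esub> h \<otimes>\<^bsub>G\<^esub> x \<otimes>\<^bsub>G\<^esub> g)"

definition twist_stabilizer :: "('a, 'm) monoid_scheme \<Rightarrow> 'a set \<Rightarrow> 'a \<Rightarrow> ('a \<times> 'a) set" where
  "twist_stabilizer G H x =
     stabilizer (G\<lparr>carrier := H\<rparr> \<times>\<times> G\<lparr>carrier := H\<rparr>) (twist G) x"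

definition burnside_kernel :: "('a, 'm) monoid_scheme \<Rightarrow> 'a set \<Rightarrow> 'a \<Rightarrow> 'a \<Rightarrow> real" where
  "burnside_kernel G H x y =
     1 / real (card (twist_stabilizer G H x)) *
     (\<Sum>hg \<in> twist_stabilizer G H x \<inter> twist_stabilizer G H y.
        1 / real (card (invariants (carrier G) (twist G) hg)))"

end

theory Submission
  imports Defs "HOL-Number_Theory.Cong"
begin

text \<open>
  Since \<open>k < p\<close>, the points can be labelled by pairs \<open>(i, r)\<close> with \<open>i < k\<close>, \<open>r < p\<close> in such a way that
  \<open>H\<close> consists of the maps \<open>(i, r) \<mapsto> (i, r + e i mod p)\<close>: this holds for one Sylow subgroup, and
  Sylow subgroups are conjugate. If \<open>\<sigma>\<close> carries the action of \<open>g \<in> H\<close> to that of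
  \<open>h \<in> H\<close>, then every block \<open>i\<close> moved by \<open>g\<close> is \<^emph>\<open>matched\<close>: \<open>\<sigma>\<close> carries the rotation of block \<open>i\<close> to a
  rotation of another block. Hence the stabilizer of \<open>\<sigma>\<close> corresponds to the exponent vectors \<open>e\<close>
  supported in the matched blocks, and \<open>T \<sigma> = 2 k - m\<close>, where \<open>m\<close> is the number of matched blocks.

  If \<open>(h, g)\<close> moves \<open>y\<close> blocks, a uniformly random fixed point of \<open>(h, g)\<close> restricts to a uniformly
  random bijection of the other \<open>k - y\<close> blocks, and the \<open>y\<close> moved blocks are all matched. So the
  conditional law of the exponent depends on \<open>y\<close> only and is governed by \<open>f(b - y; k - y)\<close>; counting
  the vectors \<open>e\<close> whose support has size \<open>y\<close> gives the factor \<open>(2 k - a choose y) (p - 1)^y\<close>.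
\<close>

section \<open>Bijections between unions of blocks\<close>

text \<open>Below \<open>p * p\<close> every multiple of \<open>p\<close> contributes exactly one
  factor \<open>p\<close> to a factorial. Hence \<open>(p * k)!\<close> contains \<open>p\<close>
  exactly \<open>k\<close> times, and \<open>k\<close> disjoint \<open>p\<close>-cycles already
  generate a Sylow subgroup; this is where \<open>k < p\<close> enters.

  Deleting the moved blocks leaves a problem of the same kind, but the blocks deleted in the domain
  and in the codomain differ. The combinatorics is therefore done for bijections between two unions
  of blocks with independent index sets, and smaller symmetric groups enter through counting alone:
  a double coset of exponent \<open>a\<close> has \<open>p ^ a\<close> elements, so a uniformly
  random bijection of \<open>k - y\<close> blocks has exponent \<open>b - y\<close> with probability
  \<open>p ^ (b - y) * f(b - y; k - y) / (p * (k - y))!\<close>.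

  For the stationary law: the identity pair fixes every permutation, so the kernel is positive
  everywhere, and orbit-stabilizer makes it reversible.\<close>

definition rot :: "nat \<Rightarrow> nat \<Rightarrow> 'i \<times> nat \<Rightarrow> 'i \<times> nat" where
  "rot p d x = (fst x, (snd x + d) mod p)"

definition shift_blocks :: "nat \<Rightarrow> ('i \<Rightarrow> nat) \<Rightarrow> 'i \<times> nat \<Rightarrow> 'i \<times> nat" where
  "shift_blocks p e x = rot p (e (fst x)) x"

definition bijections :: "'a set \<Rightarrow> 'b set \<Rightarrow> ('a \<Rightarrow> 'b) set" where
  "bijections A B = {\<sigma> \<in> extensional A. bij_betw \<sigma> A B}"

text \<open>The condition on rotations determines the rest: \<open>rot\<close> keeps the first
  component, so an injective \<open>\<sigma>\<close> carries a matched block onto one whole block.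
  The factor \<open>d\<close> may depend on the block.\<close>

definition matched :: "nat \<Rightarrow> 'i set \<Rightarrow> ('i \<times> nat \<Rightarrow> 'j \<times> nat) \<Rightarrow> 'i set" where
  "matched p I \<sigma> = {i \<in> I. \<exists>d. \<forall>r<p. \<sigma> (rot p 1 (i, r)) = rot p d (\<sigma> (i, r))}"

text \<open>The coordinate form of \<open>h \<sigma> = \<sigma> g\<close>: the vector
  \<open>e'\<close> describes the left factor \<open>h\<close>, acting on the codomain, and
  \<open>e\<close> the right factor \<open>g\<close>, acting on the domain.\<close>

definition intertwines ::
  "nat \<Rightarrow> 'i set \<Rightarrow> ('i \<times> nat \<Rightarrow> 'j \<times> nat) \<Rightarrow> ('j \<Rightarrow> nat) \<Rightarrow> ('i \<Rightarrow> nat) \<Rightarrow> bool" where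
  "intertwines p I \<sigma> e' e \<longleftrightarrow> (\<forall>x\<in>I \<times> {..<p}. \<sigma> (shift_blocks p e x) = shift_blocks p e' (\<sigma> x))"

definition supp :: "'i set \<Rightarrow> ('i \<Rightarrow> nat) \<Rightarrow> 'i set" where
  "supp I e = {i \<in> I. e i \<noteq> 0}"

lemma rot_rot: "rot p a (rot p b x) = rot p (a + b) x"
  by (simp add: rot_def mod_simps add_ac)

lemma fst_rot [simp]: "fst (rot p a x) = fst x"
  by (simp add: rot_def)

lemma fst_shift [simp]: "fst (shift_blocks p e x) = fst x"
  by (simp add: shift_blocks_def)

lemma rot_0: "snd x < p \<Longrightarrow> rot p 0 x = x"
  by (simp add: rot_def)

lemma rot_in: "p > 0 \<Longrightarrow> x \<in> I \<times> {..<p} \<Longrightarrow> rot p a x \<in> I \<times> {..<p}"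
  by (auto simp: rot_def)

lemma shift_in: "p > 0 \<Longrightarrow> x \<in> I \<times> {..<p} \<Longrightarrow> shift_blocks p e x \<in> I \<times> {..<p}"
  by (simp add: rot_in shift_blocks_def)

lemma rot_cong: "[a = b] (mod p) \<Longrightarrow> rot p a x = rot p b x"
  unfolding rot_def by (simp add: cong_def) (metis mod_add_right_eq)

lemma rot_inj: "a < p \<Longrightarrow> b < p \<Longrightarrow> rot p a x = rot p b x \<Longrightarrow> a = b"
  by (auto simp: rot_def cong_add_lcancel_nat simp flip: cong_def) (simp add: cong_def)

text \<open>The amount \<open>g\<close> may depend on the target block. Rotations never change the
  block, so \<open>g\<close> is evaluated at the same block in every step of the induction. Both a
  vector \<open>e'\<close> and a constant factor are used for \<open>g\<close>.\<close>

lemma rot_iterate: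
  assumes "p > 0" "\<And>r. r < p \<Longrightarrow> snd (\<sigma> (i, r)) < p"
    and step: "\<And>r. r < p \<Longrightarrow> \<sigma> (rot p a (i, r)) = rot p (g (fst (\<sigma> (i, r)))) (\<sigma> (i, r))"
    and "r < p"
  shows "\<sigma> (rot p (m * a) (i, r)) = rot p (m * g (fst (\<sigma> (i, r)))) (\<sigma> (i, r))"
proof (induction m)
  case 0
  then show ?case using assms by (simp add: rot_0)
next
  case (Suc m)
  obtain r' where r': "rot p (m * a) (i, r) = (i, r')" "r' < p"
    using assms(1) by (simp add: rot_def)
  have "\<sigma> (rot p (Suc m * a) (i, r)) = \<sigma> (rot p a (i, r'))"
    by (simp add: r'(1)[symmetric] rot_rot)
  also have "\<dots> = rot p (g (fst (\<sigma> (i, r')))) (\<sigma> (i, r'))" using step r' by simp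
  also have "\<sigma> (i, r') = rot p (m * g (fst (\<sigma> (i, r)))) (\<sigma> (i, r))"
    using Suc r' by simp
  finally show ?case by (simp add: rot_rot)
qed

text \<open>Primality enters here: \<open>a\<close> has an inverse \<open>u\<close> modulo
  \<open>p\<close>. Multiples of \<open>a\<close> reach every position from position 0, so all of
  block \<open>i\<close> lands in a single block; iterating \<open>u\<close> times then turns the
  rotation by \<open>a\<close> into the rotation by 1.\<close>

lemma matchedI:
  assumes p: "prime (p::nat)" and lt: "\<And>r. r < p \<Longrightarrow> snd (\<sigma> (i, r)) < p" and "i \<in> I"
    and step: "\<And>r. r < p \<Longrightarrow> \<sigma> (rot p a (i, r)) = rot p (g (fst (\<sigma> (i, r)))) (\<sigma> (i, r))"
    and a: "\<not> p dvd a"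
  shows "i \<in> matched p I \<sigma>"
proof -
  have p0: "p > 0" using p by (simp add: prime_gt_0_nat)
  have "coprime a p" using p a by (metis coprime_commute prime_imp_coprime)
  then obtain u where u: "[a * u = 1] (mod p)" using cong_solve_coprime_nat by (auto simp del: One_nat_def simp flip: One_nat_def)
  have iter: "\<sigma> (rot p (m * a) (i, r)) = rot p (m * g (fst (\<sigma> (i, r)))) (\<sigma> (i, r))"
    if "r < p" for m r
    using rot_iterate[where g = g and a = a and \<sigma> = \<sigma> and i = i and r = r] p0 lt step that by blast
  have const: "fst (\<sigma> (i, r)) = fst (\<sigma> (i, 0))" if "r < p" for r
  proof -
    have "[r * u * a = r * 1] (mod p)"
      using cong_mult[OF cong_refl[of r p] u] by (simp add: mult_ac)
    then have "rot p (r * u * a) (i, 0) = rot p r (i, 0)" by (intro rot_cong) simp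
    also have "\<dots> = (i, r)" using that by (simp add: rot_def)
    finally have "\<sigma> (i, r) = rot p (r * u * g (fst (\<sigma> (i, 0)))) (\<sigma> (i, 0))"
      using iter[OF p0, of "r * u"] by simp
    then show ?thesis by simp
  qed
  have "\<sigma> (rot p 1 (i, r)) = rot p (u * g (fst (\<sigma> (i, 0)))) (\<sigma> (i, r))" if "r < p" for r
  proof -
    have "rot p 1 (i, r) = rot p (u * a) (i, r)"
      using u by (intro rot_cong) (simp add: cong_sym mult.commute)
    then show ?thesis using iter[OF that, of u] const[OF that] by simp
  qed
  then show ?thesis using \<open>i \<in> I\<close> unfolding matched_def by blast
qed

lemma matched_rot:
  assumes "p > 0" and lt: "\<And>r. r < p \<Longrightarrow> snd (\<sigma> (i, r)) < p" and "i \<in> matched p I \<sigma>"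
  obtains d where "\<And>m r. r < p \<Longrightarrow> \<sigma> (rot p m (i, r)) = rot p (m * d) (\<sigma> (i, r))"
proof -
  from assms(3) obtain d where d: "\<And>r. r < p \<Longrightarrow> \<sigma> (rot p 1 (i, r)) = rot p d (\<sigma> (i, r))"
    by (auto simp: matched_def)
  have "\<sigma> (rot p (m * 1) (i, r)) = rot p (m * d) (\<sigma> (i, r))" if "r < p" for m r
    using rot_iterate[where g = "\<lambda>_. d" and a = 1 and \<sigma> = \<sigma> and i = i and r = r] assms(1) lt d that by blast
  then show ?thesis using that by simp
qed

lemma bijections_in: "\<sigma> \<in> bijections A B \<Longrightarrow> x \<in> A \<Longrightarrow> \<sigma> x \<in> B"
  by (auto simp: bijections_def bij_betw_def)

lemma finite_bijections: "finite A \<Longrightarrow> finite B \<Longrightarrow> finite (bijections A B)"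
  by (rule finite_subset[of _ "A \<rightarrow>\<^sub>E B"]) (auto simp: bijections_def bij_betw_def PiE_iff extensional_def finite_PiE)

lemma bij_betw_bijections:
  assumes f: "bij_betw f A' A" and g: "bij_betw g B B'"
  shows "bij_betw (\<lambda>\<sigma>. restrict (g \<circ> \<sigma> \<circ> f) A') (bijections A B) (bijections A' B')"
proof -
  let ?f = "inv_into A' f" and ?g = "inv_into B g"
  have f': "bij_betw ?f A A'" and g': "bij_betw ?g B' B"
    using f g by (simp_all add: bij_betw_inv_into)
  show ?thesis
  proof (rule bij_betw_byWitness[where f' = "\<lambda>\<sigma>. restrict (?g \<circ> \<sigma> \<circ> ?f) A"])
    show "(\<lambda>\<sigma>. restrict (g \<circ> \<sigma> \<circ> f) A') ` bijections A B \<subseteq> bijections A' B'"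
    proof clarify
      fix \<sigma> assume "\<sigma> \<in> bijections A B"
      then have "bij_betw (g \<circ> \<sigma> \<circ> f) A' B'"
        using f g by (auto simp: bijections_def intro: bij_betw_trans)
      then show "restrict (g \<circ> \<sigma> \<circ> f) A' \<in> bijections A' B'"
        by (auto simp: bijections_def cong: bij_betw_cong)
    qed
    show "(\<lambda>\<sigma>. restrict (?g \<circ> \<sigma> \<circ> ?f) A) ` bijections A' B' \<subseteq> bijections A B"
    proof clarify
      fix \<sigma> assume "\<sigma> \<in> bijections A' B'"
      then have "bij_betw (?g \<circ> \<sigma> \<circ> ?f) A B"
        using f' g' by (auto simp: bijections_def intro: bij_betw_trans)
      then show "restrict (?g \<circ> \<sigma> \<circ> ?f) A \<in> bijections A B"
        by (auto simp: bijections_def cong: bij_betw_cong)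
    qed
    show "\<forall>\<sigma>\<in>bijections A B. restrict (?g \<circ> restrict (g \<circ> \<sigma> \<circ> f) A' \<circ> ?f) A = \<sigma>"
    proof
      fix \<sigma> assume \<sigma>: "\<sigma> \<in> bijections A B"
      show "restrict (?g \<circ> restrict (g \<circ> \<sigma> \<circ> f) A' \<circ> ?f) A = \<sigma>"
      proof
        fix x show "restrict (?g \<circ> restrict (g \<circ> \<sigma> \<circ> f) A' \<circ> ?f) A x = \<sigma> x"
          using \<sigma> f g bij_betwE[OF f'] bijections_in[OF \<sigma>, of x]
          by (cases "x \<in> A") (auto simp: bij_betw_inv_into_right bij_betw_inv_into_left
              bijections_def extensional_def)
      qed
    qed
    show "\<forall>\<sigma>\<in>bijections A' B'. restrict (g \<circ> restrict (?g \<circ> \<sigma> \<circ> ?f) A \<circ> f) A' = \<sigma>"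
    proof
      fix \<sigma> assume \<sigma>: "\<sigma> \<in> bijections A' B'"
      show "restrict (g \<circ> restrict (?g \<circ> \<sigma> \<circ> ?f) A \<circ> f) A' = \<sigma>"
      proof
        fix x show "restrict (g \<circ> restrict (?g \<circ> \<sigma> \<circ> ?f) A \<circ> f) A' x = \<sigma> x"
          using \<sigma> f g bij_betwE[OF f] bijections_in[OF \<sigma>, of x]
          by (cases "x \<in> A'") (auto simp: bij_betw_inv_into_right bij_betw_inv_into_left
              bijections_def extensional_def)
      qed
    qed
  qed
qed

lemma shift_eq_iff:
  assumes "x \<in> A \<times> {..<p}" "g \<in> A \<rightarrow>\<^sub>E {..<p}"
  shows "shift_blocks p g x = x \<longleftrightarrow> g (fst x) = 0"
proof -
  have *: "g (fst x) < p" "0 < p" "rot p 0 x = x" using assms by (auto simp: rot_0)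
  then have "rot p (g (fst x)) x = x \<longleftrightarrow> g (fst x) = 0" using rot_inj by metis
  then show ?thesis by (simp add: shift_blocks_def)
qed

section \<open>Matched blocks and pairs of shifts intertwined by a bijection\<close>

locale block_bijection =
  fixes p :: nat and I :: "'i set" and I' :: "'j set" and \<sigma> :: "'i \<times> nat \<Rightarrow> 'j \<times> nat"
  assumes p: "prime p" and \<sigma>: "\<sigma> \<in> bijections (I \<times> {..<p}) (I' \<times> {..<p})"
begin

lemma p0: "p > 0"
  using p by (simp add: prime_gt_0_nat)

lemma into: "i \<in> I \<Longrightarrow> r < p \<Longrightarrow> fst (\<sigma> (i, r)) \<in> I' \<and> snd (\<sigma> (i, r)) < p"
  using bijections_in[OF \<sigma>, of "(i, r)"] by auto

lemma inj: "x \<in> I \<times> {..<p} \<Longrightarrow> y \<in> I \<times> {..<p} \<Longrightarrow> \<sigma> x = \<sigma> y \<Longrightarrow> x = y"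
  using \<sigma> by (auto simp: bijections_def bij_betw_def dest: inj_onD)

lemma matched_subset: "matched p I \<sigma> \<subseteq> I"
  by (auto simp: matched_def)

lemma obtain_rot:
  assumes "i \<in> matched p I \<sigma>"
  obtains d where "\<And>m r. r < p \<Longrightarrow> \<sigma> (rot p m (i, r)) = rot p (m * d) (\<sigma> (i, r))"
proof -
  have "i \<in> I" using assms matched_subset by auto
  then show ?thesis using matched_rot[of p \<sigma> i I] p0 into assms that by metis
qed

text \<open>The image stays inside one block because rotations do, and injectivity gives it
  \<open>p\<close> elements, which fills that block.\<close>

lemma image_block:
  assumes i: "i \<in> matched p I \<sigma>"
  shows "\<sigma> ` ({i} \<times> {..<p}) = {fst (\<sigma> (i, 0))} \<times> {..<p}"
proof (rule card_subset_eq)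
  have iI: "i \<in> I" using i matched_subset by auto
  from i obtain d where d: "\<And>m r. r < p \<Longrightarrow> \<sigma> (rot p m (i, r)) = rot p (m * d) (\<sigma> (i, r))"
    using obtain_rot by blast
  have "\<sigma> (i, r) = rot p (r * d) (\<sigma> (i, 0))" if "r < p" for r
    using d[OF p0, of r] that by (simp add: rot_def)
  then have const: "fst (\<sigma> (i, r)) = fst (\<sigma> (i, 0))" if "r < p" for r using that by (metis fst_rot)
  show "\<sigma> ` ({i} \<times> {..<p}) \<subseteq> {fst (\<sigma> (i, 0))} \<times> {..<p}"
  proof
    fix y assume "y \<in> \<sigma> ` ({i} \<times> {..<p})"
    then obtain r where r: "r < p" "y = \<sigma> (i, r)" by auto
    then have "fst y = fst (\<sigma> (i, 0))" "snd y < p" using const into[OF iI] by metis+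
    then show "y \<in> {fst (\<sigma> (i, 0))} \<times> {..<p}" by (simp add: mem_Times_iff)
  qed
  have "inj_on \<sigma> ({i} \<times> {..<p})" using inj iI by (intro inj_onI) auto
  then show "card (\<sigma> ` ({i} \<times> {..<p})) = card ({fst (\<sigma> (i, 0))} \<times> {..<p})"
    by (simp add: card_image card_cartesian_product)
qed simp

text \<open>The target block is already filled by the image of block \<open>i\<close>, so by
  injectivity no other block can reach it.\<close>

lemma matched_unique:
  assumes i: "i \<in> matched p I \<sigma>" and x: "x \<in> I \<times> {..<p}" "fst (\<sigma> x) = fst (\<sigma> (i, 0))"
  shows "fst x = i"
proof -
  have "\<sigma> x \<in> \<sigma> ` ({i} \<times> {..<p})"
    unfolding image_block[OF i] using x bijections_in[OF \<sigma> x(1)] by (auto simp: mem_Times_iff)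
  then obtain r where "r < p" "\<sigma> x = \<sigma> (i, r)" by auto
  then have "x = (i, r)" using i x matched_subset by (intro inj) auto
  then show ?thesis by simp
qed

lemma intertwines_supp:
  assumes int: "intertwines p I \<sigma> e' e" and e: "e \<in> I \<rightarrow>\<^sub>E {..<p}"
  shows "supp I e \<subseteq> matched p I \<sigma>"
proof
  fix i assume "i \<in> supp I e"
  then have i: "i \<in> I" "e i \<noteq> 0" "e i < p" using e by (auto simp: supp_def)
  then have "\<not> p dvd e i" by (auto dest: dvd_imp_le)
  moreover have "\<sigma> (rot p (e i) (i, r)) = rot p (e' (fst (\<sigma> (i, r)))) (\<sigma> (i, r))" if "r < p" for r
    using int i that by (auto simp: intertwines_def shift_blocks_def)
  ultimately show "i \<in> matched p I \<sigma>"
    using i into by (intro matchedI[OF p, where a = "e i" and g = e']) auto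
qed

lemma intertwines_exists:
  assumes e: "e \<in> I \<rightarrow>\<^sub>E {..<p}" and sub: "supp I e \<subseteq> matched p I \<sigma>"
  obtains e' where "e' \<in> I' \<rightarrow>\<^sub>E {..<p}" "intertwines p I \<sigma> e' e"
proof -
  let ?M = "matched p I \<sigma>"
  have "\<forall>i\<in>?M. \<exists>d. \<forall>m r. r < p \<longrightarrow> \<sigma> (rot p m (i, r)) = rot p (m * d) (\<sigma> (i, r))"
  proof
    fix i assume "i \<in> ?M"
    then obtain d where "\<And>m r. r < p \<Longrightarrow> \<sigma> (rot p m (i, r)) = rot p (m * d) (\<sigma> (i, r))"
      using obtain_rot by blast
    then show "\<exists>d. \<forall>m r. r < p \<longrightarrow> \<sigma> (rot p m (i, r)) = rot p (m * d) (\<sigma> (i, r))" by blast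
  qed
  then obtain d where d: "\<And>i m r. i \<in> ?M \<Longrightarrow> r < p \<Longrightarrow>
      \<sigma> (rot p m (i, r)) = rot p (m * d i) (\<sigma> (i, r))" by metis
  define P where "P i' i \<longleftrightarrow> i \<in> ?M \<and> fst (\<sigma> (i, 0)) = i'" for i' i
  have P_unique: "i = j" if "P i' i" "P i' j" for i i' j
    using that matched_unique[of i "(j, 0)"] matched_subset p0 by (auto simp: P_def)
  \<comment> \<open>\<open>d i\<close> is the factor by which \<open>\<sigma>\<close> rescales the
    rotations of a matched block \<open>i\<close>, so the target of block \<open>i\<close> has to
    rotate by \<open>e i * d i\<close>. All other blocks stay fixed, hence the default 0.\<close>
  define e' where "e' = (\<lambda>i'\<in>I'. if \<exists>i. P i' i then (e (THE i. P i' i) * d (THE i. P i' i)) mod p else 0)"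
  have "intertwines p I \<sigma> e' e"
    unfolding intertwines_def
  proof
    fix x assume x: "x \<in> I \<times> {..<p}"
    obtain i r where ir: "x = (i, r)" "i \<in> I" "r < p" using x by auto
    show "\<sigma> (shift_blocks p e x) = shift_blocks p e' (\<sigma> x)"
    proof (cases "i \<in> ?M")
      case True
      have "\<sigma> (i, r) \<in> {fst (\<sigma> (i, 0))} \<times> {..<p}"
        unfolding image_block[OF True, symmetric] using ir by auto
      then have P: "P (fst (\<sigma> (i, r))) i" using True by (auto simp: P_def)
      then have "(THE j. P (fst (\<sigma> (i, r))) j) = i" using P_unique by (intro the_equality)
      then have "e' (fst (\<sigma> (i, r))) = (e i * d i) mod p"
        using P into[OF ir(2,3)] by (auto simp: e'_def simp del: not_ex)
      then have "shift_blocks p e' (\<sigma> x) = rot p (e i * d i) (\<sigma> x)"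
        unfolding shift_blocks_def using ir by (auto intro!: rot_cong simp: cong_def)
      then show ?thesis using d[OF True ir(3)] ir by (simp add: shift_blocks_def)
    next
      case False
      have e0: "e i = 0" using False sub ir by (auto simp: supp_def)
      \<comment> \<open>An unmatched block never meets the target of a matched one, so
        \<open>e'\<close> is 0 wherever its points go.\<close>
      have "\<not> P (fst (\<sigma> x)) j" for j
        using matched_unique[of j x] x False ir by (auto simp: P_def)
      then have "e' (fst (\<sigma> x)) = 0" using into[OF ir(2,3)] ir by (auto simp: e'_def)
      then show ?thesis using e0 ir into[OF ir(2,3)] by (simp add: shift_blocks_def rot_0)
    qed
  qed
  moreover have "e' \<in> I' \<rightarrow>\<^sub>E {..<p}" using p0 by (auto simp: e'_def)
  ultimately show ?thesis using that by blast
qed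

lemma surj: "y \<in> I' \<times> {..<p} \<Longrightarrow> \<exists>x\<in>I \<times> {..<p}. \<sigma> x = y"
  using \<sigma> unfolding bijections_def bij_betw_def by (metis (mono_tags, lifting) imageE mem_Collect_eq)

lemma intertwines_unique:
  assumes "intertwines p I \<sigma> e1 e" "intertwines p I \<sigma> e2 e"
    and e: "e1 \<in> I' \<rightarrow>\<^sub>E {..<p}" "e2 \<in> I' \<rightarrow>\<^sub>E {..<p}"
  shows "e1 = e2"
proof (rule PiE_ext[OF e])
  fix i' assume i': "i' \<in> I'"
  then have "(i', 0) \<in> I' \<times> {..<p}" using p0 by simp
  then obtain x where x: "x \<in> I \<times> {..<p}" "\<sigma> x = (i', 0)" using surj by blast
  have "shift_blocks p e1 (\<sigma> x) = shift_blocks p e2 (\<sigma> x)"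
    using assms(1,2) x(1) unfolding intertwines_def by metis
  then have "rot p (e1 i') (i', 0) = rot p (e2 i') (i', 0)" by (simp add: x(2) shift_blocks_def)
  moreover have "e1 i' < p" "e2 i' < p" using e i' by auto
  ultimately show "e1 i' = e2 i'" using rot_inj by metis
qed

text \<open>A point lies in a moved block iff the shift moves it, and an injective intertwiner
  carries the fixed points of one shift to those of the other.\<close>

lemma image_supp:
  assumes int: "intertwines p I \<sigma> e' e" and e: "e \<in> I \<rightarrow>\<^sub>E {..<p}" "e' \<in> I' \<rightarrow>\<^sub>E {..<p}"
  shows "\<sigma> ` (supp I e \<times> {..<p}) = supp I' e' \<times> {..<p}"
proof -
  have eq: "fst x \<in> supp I e \<longleftrightarrow> fst (\<sigma> x) \<in> supp I' e'" if x: "x \<in> I \<times> {..<p}" for x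
  proof -
    have sx: "\<sigma> x \<in> I' \<times> {..<p}" using bijections_in[OF \<sigma> x] .
    have "shift_blocks p e x = x \<longleftrightarrow> \<sigma> (shift_blocks p e x) = \<sigma> x"
      using inj[OF shift_in[OF p0 x] x, of e] by auto
    also have "\<dots> \<longleftrightarrow> shift_blocks p e' (\<sigma> x) = \<sigma> x" using bspec[OF int[unfolded intertwines_def] x] by simp
    finally show ?thesis
      using shift_eq_iff[OF x e(1)] shift_eq_iff[OF sx e(2)] x sx by (auto simp: supp_def mem_Times_iff)
  qed
  show ?thesis
  proof (intro equalityI subsetI)
    fix y assume "y \<in> \<sigma> ` (supp I e \<times> {..<p})"
    then obtain x where x: "x \<in> I \<times> {..<p}" "fst x \<in> supp I e" "y = \<sigma> x" by (auto simp: supp_def)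
    then show "y \<in> supp I' e' \<times> {..<p}"
      using eq[OF x(1)] bijections_in[OF \<sigma> x(1)] by (auto simp: mem_Times_iff)
  next
    fix y assume y: "y \<in> supp I' e' \<times> {..<p}"
    then have "y \<in> I' \<times> {..<p}" by (auto simp: supp_def)
    then obtain x where x: "x \<in> I \<times> {..<p}" "\<sigma> x = y" using surj by blast
    then have "x \<in> supp I e \<times> {..<p}" using y eq[OF x(1)] by (auto simp: mem_Times_iff)
    then show "y \<in> \<sigma> ` (supp I e \<times> {..<p})" using x by auto
  qed
qed

end

section \<open>Counting exponent vectors by their support\<close>

lemma card_supp:
  fixes p :: nat
  assumes "finite I" "J \<subseteq> I" "p > 0"
  shows "card {e \<in> I \<rightarrow>\<^sub>E {..<p}. supp I e = J} = (p - 1) ^ card J"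
proof -
  have "{e \<in> I \<rightarrow>\<^sub>E {..<p}. supp I e = J} = (\<Pi>\<^sub>E i\<in>I. if i \<in> J then {1..<p} else {0})"
  proof (rule Set.set_eqI)
    fix e :: "'a \<Rightarrow> nat"
    have "supp I e = J \<longleftrightarrow> (\<forall>i\<in>I. e i \<noteq> 0 \<longleftrightarrow> i \<in> J)" using assms by (auto simp: supp_def)
    moreover have "e i \<in> (if i \<in> J then {1..<p} else {0}) \<longleftrightarrow> e i < p \<and> (e i \<noteq> 0 \<longleftrightarrow> i \<in> J)" for i
      using assms by auto
    ultimately show "e \<in> {e \<in> I \<rightarrow>\<^sub>E {..<p}. supp I e = J}
        \<longleftrightarrow> e \<in> (\<Pi>\<^sub>E i\<in>I. if i \<in> J then {1..<p} else {0})"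
      by (simp only: PiE_iff mem_Collect_eq lessThan_iff) blast
  qed
  then have "card {e \<in> I \<rightarrow>\<^sub>E {..<p}. supp I e = J} = (\<Prod>i\<in>I. if i \<in> J then p - 1 else 1)"
    using assms by (simp add: card_PiE if_distrib[of card] cong: if_cong)
  also have "\<dots> = (p - 1) ^ card J"
    using assms by (simp add: prod.If_cases Int_absorb1)
  finally show ?thesis .
qed

lemma card_supp_subset:
  fixes p :: nat
  assumes "finite I" "M \<subseteq> I" "p > 0"
  shows "card {e \<in> I \<rightarrow>\<^sub>E {..<p}. supp I e \<subseteq> M} = p ^ card M"
proof -
  have "{e \<in> I \<rightarrow>\<^sub>E {..<p}. supp I e \<subseteq> M} = (\<Pi>\<^sub>E i\<in>I. if i \<in> M then {..<p} else {0})"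
  proof (rule Set.set_eqI)
    fix e :: "'a \<Rightarrow> nat"
    have "supp I e \<subseteq> M \<longleftrightarrow> (\<forall>i\<in>I. e i \<noteq> 0 \<longrightarrow> i \<in> M)" using assms by (auto simp: supp_def)
    moreover have "e i \<in> (if i \<in> M then {..<p} else {0}) \<longleftrightarrow> e i < p \<and> (e i \<noteq> 0 \<longrightarrow> i \<in> M)" for i
      using assms by auto
    ultimately show "e \<in> {e \<in> I \<rightarrow>\<^sub>E {..<p}. supp I e \<subseteq> M}
        \<longleftrightarrow> e \<in> (\<Pi>\<^sub>E i\<in>I. if i \<in> M then {..<p} else {0})"
      by (simp only: PiE_iff mem_Collect_eq lessThan_iff) blast
  qed
  then have "card {e \<in> I \<rightarrow>\<^sub>E {..<p}. supp I e \<subseteq> M} = (\<Prod>i\<in>I. if i \<in> M then p else 1)"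
    using assms by (simp add: card_PiE if_distrib[of card] cong: if_cong)
  also have "\<dots> = p ^ card M"
    using assms by (simp add: prod.If_cases Int_absorb1)
  finally show ?thesis .
qed

lemma card_supp_subset_card:
  fixes p :: nat
  assumes fin: "finite I" and M: "M \<subseteq> I" and p: "p > 0"
  shows "card {e \<in> I \<rightarrow>\<^sub>E {..<p}. supp I e \<subseteq> M \<and> card (supp I e) = y}
    = (card M choose y) * (p - 1) ^ y"
proof -
  have finM: "finite M" using fin M by (rule rev_finite_subset)
  have "{e \<in> I \<rightarrow>\<^sub>E {..<p}. supp I e \<subseteq> M \<and> card (supp I e) = y}
      = (\<Union>J\<in>{J. J \<subseteq> M \<and> card J = y}. {e \<in> I \<rightarrow>\<^sub>E {..<p}. supp I e = J})" by auto
  then have "card {e \<in> I \<rightarrow>\<^sub>E {..<p}. supp I e \<subseteq> M \<and> card (supp I e) = y}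
      = (\<Sum>J\<in>{J. J \<subseteq> M \<and> card J = y}. card {e \<in> I \<rightarrow>\<^sub>E {..<p}. supp I e = J})"
    using finM fin
    by (simp only:, subst card_UN_disjoint) (auto simp: finite_PiE)
  also have "\<dots> = (\<Sum>J\<in>{J. J \<subseteq> M \<and> card J = y}. (p - 1) ^ y)"
    using card_supp[OF fin _ p] M by (intro sum.cong) auto
  also have "\<dots> = (card M choose y) * (p - 1) ^ y"
    using n_subsets[OF finM, of y] by simp
  finally show ?thesis .
qed

text \<open>The stabilizer of \<open>\<sigma>\<close> under the twisted action, with group elements
  replaced by their exponent vectors.\<close>

definition stab_pairs ::
  "nat \<Rightarrow> 'i set \<Rightarrow> 'j set \<Rightarrow> ('i \<times> nat \<Rightarrow> 'j \<times> nat) \<Rightarrow> (('j \<Rightarrow> nat) \<times> ('i \<Rightarrow> nat)) set" where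
  "stab_pairs p I I' \<sigma> =
     {(e', e) \<in> (I' \<rightarrow>\<^sub>E {..<p}) \<times> (I \<rightarrow>\<^sub>E {..<p}). intertwines p I \<sigma> e' e}"

text \<open>The second vector determines the first because \<open>\<sigma>\<close> is surjective,
  and a partner exists exactly when no unmatched block is moved.\<close>

lemma (in block_bijection) bij_betw_stab_pairs:
  "bij_betw snd (stab_pairs p I I' \<sigma>) {e \<in> I \<rightarrow>\<^sub>E {..<p}. supp I e \<subseteq> matched p I \<sigma>}"
  unfolding bij_betw_def
proof
  show "inj_on snd (stab_pairs p I I' \<sigma>)"
    using intertwines_unique by (force simp: inj_on_def stab_pairs_def)
  show "snd ` stab_pairs p I I' \<sigma> = {e \<in> I \<rightarrow>\<^sub>E {..<p}. supp I e \<subseteq> matched p I \<sigma>}"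
  proof (intro equalityI subsetI)
    fix e assume "e \<in> snd ` stab_pairs p I I' \<sigma>"
    then show "e \<in> {e \<in> I \<rightarrow>\<^sub>E {..<p}. supp I e \<subseteq> matched p I \<sigma>}"
      using intertwines_supp by (force simp: stab_pairs_def)
  next
    fix e assume "e \<in> {e \<in> I \<rightarrow>\<^sub>E {..<p}. supp I e \<subseteq> matched p I \<sigma>}"
    then obtain e' where "e' \<in> I' \<rightarrow>\<^sub>E {..<p}" "intertwines p I \<sigma> e' e" "e \<in> I \<rightarrow>\<^sub>E {..<p}"
      using intertwines_exists by blast
    then have "(e', e) \<in> stab_pairs p I I' \<sigma>" by (simp add: stab_pairs_def)
    then show "e \<in> snd ` stab_pairs p I I' \<sigma>" by force
  qed
qed

lemma (in block_bijection) card_stab_pairs: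
  assumes "finite I"
  shows "card (stab_pairs p I I' \<sigma>) = p ^ card (matched p I \<sigma>)"
  using bij_betw_same_card[OF bij_betw_stab_pairs] card_supp_subset[OF assms matched_subset p0]
  by simp

section \<open>Splitting a fixed bijection along the moved blocks\<close>

lemma bijections_restrict:
  assumes "\<sigma> \<in> bijections A B" "C \<subseteq> A" "\<sigma> ` C = D"
  shows "restrict \<sigma> C \<in> bijections C D"
proof -
  have "bij_betw \<sigma> C D" using assms by (auto simp: bijections_def intro: bij_betw_subset)
  then show ?thesis by (auto simp: bijections_def cong: bij_betw_cong)
qed

text \<open>A bijection fixed by \<open>(e', e)\<close> is an equivariant bijection of the blocks in the supports
  together with an arbitrary bijection of the remaining blocks.\<close>

lemma (in block_bijection) card_fixed:
  assumes int: "intertwines p I \<sigma> e' e" and e: "e \<in> I \<rightarrow>\<^sub>E {..<p}" "e' \<in> I' \<rightarrow>\<^sub>E {..<p}"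
    and J: "J = supp I e" and J': "J' = supp I' e'" and fin: "finite I" "finite I'"
  obtains c where "c > 0"
    "\<And>Pr. card {\<tau> \<in> bijections (I \<times> {..<p}) (I' \<times> {..<p}).
        intertwines p I \<tau> e' e \<and> Pr (card (matched p I \<tau>))}
      = c * card {\<rho> \<in> bijections ((I - J) \<times> {..<p}) ((I' - J') \<times> {..<p}).
          Pr (card J + card (matched p (I - J) \<rho>))}"
proof -
  define F where "F = {\<tau> \<in> bijections (I \<times> {..<p}) (I' \<times> {..<p}). intertwines p I \<tau> e' e}"
  define A where "A = {\<alpha> \<in> bijections (J \<times> {..<p}) (J' \<times> {..<p}). intertwines p J \<alpha> e' e}"
  define B where "B = bijections ((I - J) \<times> {..<p}) ((I' - J') \<times> {..<p})"
  define \<Phi> where "\<Phi> \<tau> = (restrict \<tau> (J \<times> {..<p}), restrict \<tau> ((I - J) \<times> {..<p}))"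
    for \<tau> :: "'i \<times> nat \<Rightarrow> 'j \<times> nat"
  define \<Psi> where "\<Psi> = (\<lambda>(\<alpha>, \<rho>) (x :: 'i \<times> nat). if fst x \<in> J then \<alpha> x else \<rho> x :: 'j \<times> nat)"
  have sub: "J \<subseteq> I" "J' \<subseteq> I'" by (auto simp: J J' supp_def)
  have diff: "(I \<times> {..<p}) - (J \<times> {..<p}) = (I - J) \<times> {..<p}"
    "(I' \<times> {..<p}) - (J' \<times> {..<p}) = (I' - J') \<times> {..<p}" by auto
  have F_to: "\<Phi> \<tau> \<in> A \<times> B" if \<tau>: "\<tau> \<in> F" for \<tau>
  proof -
    have \<tau>b: "\<tau> \<in> bijections (I \<times> {..<p}) (I' \<times> {..<p})" and \<tau>i: "intertwines p I \<tau> e' e"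
      using \<tau> by (auto simp: F_def)
    interpret \<tau>: block_bijection p I I' \<tau> using p \<tau>b by unfold_locales
    have im: "\<tau> ` (J \<times> {..<p}) = J' \<times> {..<p}"
      unfolding J J' by (rule \<tau>.image_supp[OF \<tau>i e])
    have "\<tau> ` (I \<times> {..<p} - J \<times> {..<p}) = \<tau> ` (I \<times> {..<p}) - \<tau> ` (J \<times> {..<p})"
      using \<tau>b sub by (intro inj_on_image_set_diff) (auto simp: bijections_def bij_betw_def)
    then have im2: "\<tau> ` ((I - J) \<times> {..<p}) = (I' - J') \<times> {..<p}"
      using im \<tau>b diff by (simp add: bijections_def bij_betw_def)
    have "restrict \<tau> (J \<times> {..<p}) \<in> bijections (J \<times> {..<p}) (J' \<times> {..<p})"
      by (rule bijections_restrict[OF \<tau>b _ im]) (use sub in auto)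
    moreover have "intertwines p J (restrict \<tau> (J \<times> {..<p})) e' e"
      unfolding intertwines_def
    proof
      fix x assume x: "x \<in> J \<times> {..<p}"
      then have "x \<in> I \<times> {..<p}" using sub by auto
      then have "\<tau> (shift_blocks p e x) = shift_blocks p e' (\<tau> x)" using \<tau>i unfolding intertwines_def by blast
      then show "restrict \<tau> (J \<times> {..<p}) (shift_blocks p e x) = shift_blocks p e' (restrict \<tau> (J \<times> {..<p}) x)"
        using x shift_in[OF p0 x] by simp
    qed
    moreover have "restrict \<tau> ((I - J) \<times> {..<p}) \<in> B"
      unfolding B_def by (rule bijections_restrict[OF \<tau>b _ im2]) auto
    ultimately show ?thesis by (simp add: A_def \<Phi>_def)
  qed
  have to_F: "\<Psi> (\<alpha>, \<rho>) \<in> F" if \<alpha>: "\<alpha> \<in> A" and \<rho>: "\<rho> \<in> B" for \<alpha> \<rho>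
  proof -
    have \<Psi>1: "\<Psi> (\<alpha>, \<rho>) x = \<alpha> x" if "x \<in> J \<times> {..<p}" for x using that by (auto simp: \<Psi>_def)
    have \<Psi>2: "\<Psi> (\<alpha>, \<rho>) x = \<rho> x" if "x \<in> (I - J) \<times> {..<p}" for x using that by (auto simp: \<Psi>_def)
    have "bij_betw (\<Psi> (\<alpha>, \<rho>)) (J \<times> {..<p}) (J' \<times> {..<p})"
      using \<alpha> by (subst bij_betw_cong[OF \<Psi>1]) (auto simp: A_def bijections_def)
    moreover have "bij_betw (\<Psi> (\<alpha>, \<rho>)) ((I - J) \<times> {..<p}) ((I' - J') \<times> {..<p})"
      using \<rho> by (subst bij_betw_cong[OF \<Psi>2]) (auto simp: B_def bijections_def)
    ultimately have "bij_betw (\<Psi> (\<alpha>, \<rho>)) (J \<times> {..<p} \<union> (I - J) \<times> {..<p})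
        (J' \<times> {..<p} \<union> (I' - J') \<times> {..<p})"
      by (rule bij_betw_combine) auto
    moreover have "J \<times> {..<p} \<union> (I - J) \<times> {..<p} = I \<times> {..<p}"
      "J' \<times> {..<p} \<union> (I' - J') \<times> {..<p} = I' \<times> {..<p}" using sub by auto
    moreover have "\<Psi> (\<alpha>, \<rho>) \<in> extensional (I \<times> {..<p})"
      using \<alpha> \<rho> sub by (auto simp: \<Psi>_def A_def B_def bijections_def extensional_def)
    moreover have "intertwines p I (\<Psi> (\<alpha>, \<rho>)) e' e"
      unfolding intertwines_def
    proof
      fix x assume x: "x \<in> I \<times> {..<p}"
      show "\<Psi> (\<alpha>, \<rho>) (shift_blocks p e x) = shift_blocks p e' (\<Psi> (\<alpha>, \<rho>) x)"
      proof (cases "x \<in> J \<times> {..<p}")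
        case True
        then have "\<alpha> (shift_blocks p e x) = shift_blocks p e' (\<alpha> x)"
          using \<alpha> unfolding A_def intertwines_def by blast
        then show ?thesis using \<Psi>1[OF True] \<Psi>1[OF shift_in[OF p0 True]] by simp
      next
        case False
        then have x': "x \<in> (I - J) \<times> {..<p}" using x by auto
        have "shift_blocks p e x = x" using x x' shift_eq_iff[OF x e(1)] by (auto simp: J supp_def)
        moreover have \<rho>x: "\<rho> x \<in> (I' - J') \<times> {..<p}" using \<rho> x' unfolding B_def by (rule bijections_in)
        then have "\<rho> x \<in> I' \<times> {..<p}" by auto
        then have "shift_blocks p e' (\<rho> x) = \<rho> x" using \<rho>x shift_eq_iff[OF _ e(2)] by (auto simp: J' supp_def)
        ultimately show ?thesis using \<Psi>2[OF x'] by simp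
      qed
    qed
    ultimately show ?thesis by (simp add: F_def bijections_def)
  qed
  have bij: "bij_betw \<Phi> F (A \<times> B)"
  proof (rule bij_betw_byWitness[where f' = \<Psi>])
    show "\<Phi> ` F \<subseteq> A \<times> B" using F_to by blast
    show "\<Psi> ` (A \<times> B) \<subseteq> F" using to_F by auto
    show "\<forall>\<tau>\<in>F. \<Psi> (\<Phi> \<tau>) = \<tau>"
    proof (intro ballI ext)
      fix \<tau> and x :: "'i \<times> nat" assume "\<tau> \<in> F"
      then have "\<tau> x = undefined" if "x \<notin> I \<times> {..<p}" using that
        by (cases x) (auto simp: F_def bijections_def extensional_def)
      then show "\<Psi> (\<Phi> \<tau>) x = \<tau> x" using sub by (cases x) (auto simp: \<Psi>_def \<Phi>_def)
    qed
    show "\<forall>x\<in>A \<times> B. \<Phi> (\<Psi> x) = x"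
    proof
      fix z assume "z \<in> A \<times> B"
      then have "fst z \<in> extensional (J \<times> {..<p})" "snd z \<in> extensional ((I - J) \<times> {..<p})"
        by (auto simp: A_def B_def bijections_def)
      then have "restrict (\<Psi> z) (J \<times> {..<p}) = fst z" "restrict (\<Psi> z) ((I - J) \<times> {..<p}) = snd z"
        by (auto simp: \<Psi>_def fun_eq_iff extensional_def restrict_def split_beta)
      then show "\<Phi> (\<Psi> z) = z" by (simp add: \<Phi>_def)
    qed
  qed
  \<comment> \<open>Blocks in \<open>J\<close> are matched because \<open>\<tau>\<close> intertwines
    \<open>e'\<close> and \<open>e\<close>. For the others, a rotation never leaves its block, so
    restricting \<open>\<tau>\<close> does not change whether the block is matched.\<close>
  have matched: "card (matched p I \<tau>) = card J + card (matched p (I - J) (snd (\<Phi> \<tau>)))" if \<tau>: "\<tau> \<in> F" for \<tau>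
  proof -
    have \<tau>b: "\<tau> \<in> bijections (I \<times> {..<p}) (I' \<times> {..<p})" and \<tau>i: "intertwines p I \<tau> e' e"
      using \<tau> by (auto simp: F_def)
    interpret \<tau>: block_bijection p I I' \<tau> using p \<tau>b by unfold_locales
    have "J \<subseteq> matched p I \<tau>" unfolding J by (rule \<tau>.intertwines_supp[OF \<tau>i e(1)])
    moreover have "matched p (I - J) (snd (\<Phi> \<tau>)) = matched p I \<tau> - J"
    proof -
      have "rot p 1 (i, r) \<in> (I - J) \<times> {..<p}" if "i \<in> I - J" "r < p" for i r
        using that p0 by (intro rot_in) auto
      then show ?thesis by (auto simp: matched_def \<Phi>_def simp del: One_nat_def)
    qed
    ultimately show ?thesis
      using \<tau>.matched_subset fin by (metis card_Diff_subset card_mono finite_subset le_add_diff_inverse)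
  qed
  \<comment> \<open>The constant \<open>c\<close> is \<open>card A\<close>. It is positive since
    \<open>\<sigma>\<close> itself is fixed by the pair, so its restriction to \<open>J\<close>
    belongs to \<open>A\<close>.\<close>
  have "\<sigma> \<in> F" using \<sigma> int by (simp add: F_def)
  then have "A \<noteq> {}" using F_to by auto
  moreover have "finite J" "finite J'" using sub fin by (auto intro: finite_subset)
  then have "finite A" unfolding A_def
    by (intro finite_subset[OF _ finite_bijections[of "J \<times> {..<p}" "J' \<times> {..<p}"]]) auto
  ultimately have "card A > 0" by (simp add: card_gt_0_iff)
  moreover have "card {\<tau> \<in> bijections (I \<times> {..<p}) (I' \<times> {..<p}).
        intertwines p I \<tau> e' e \<and> Pr (card (matched p I \<tau>))}
      = card A * card {\<rho> \<in> B. Pr (card J + card (matched p (I - J) \<rho>))}" for Pr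
  proof -
    have b: "bij_betw \<Phi> {\<tau> \<in> F. Pr (card (matched p I \<tau>))}
      {z \<in> A \<times> B. Pr (card J + card (matched p (I - J) (snd z)))}"
      using bij matched by (intro bij_betw_Collect) auto
    have eq: "{z \<in> A \<times> B. Pr (card J + card (matched p (I - J) (snd z)))}
      = A \<times> {\<rho> \<in> B. Pr (card J + card (matched p (I - J) \<rho>))}" by auto
    have "card {\<tau> \<in> F. Pr (card (matched p I \<tau>))}
      = card (A \<times> {\<rho> \<in> B. Pr (card J + card (matched p (I - J) \<rho>))})"
      using bij_betw_same_card[OF b] by (simp only: eq)
    then show ?thesis by (simp add: card_cartesian_product F_def conj_assoc)
  qed
  ultimately show ?thesis using that[of "card A"] by (simp add: B_def)
qed

section \<open>Relabelling blocks and reading permutations in coordinates\<close>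

text \<open>Relabelling acts on the first component only and so commutes with all rotations.\<close>

lemma matched_reindex:
  assumes p: "p > 0" and \<alpha>: "bij_betw \<alpha> K I" and \<beta>: "bij_betw \<beta> I' K'"
    and \<sigma>: "\<sigma> \<in> bijections (I \<times> {..<p}) (I' \<times> {..<p})"
  shows "card (matched p K (restrict (map_prod \<beta> id \<circ> \<sigma> \<circ> map_prod \<alpha> id) (K \<times> {..<p})))
    = card (matched p I \<sigma>)"
proof -
  let ?\<sigma> = "restrict (map_prod \<beta> id \<circ> \<sigma> \<circ> map_prod \<alpha> id) (K \<times> {..<p})"
  have "i \<in> matched p K ?\<sigma> \<longleftrightarrow> \<alpha> i \<in> matched p I \<sigma>" if i: "i \<in> K" for i
  proof -
    have \<alpha>i: "\<alpha> i \<in> I" using \<alpha> i by (auto simp: bij_betw_def)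
    have "?\<sigma> (rot p 1 (i, r)) = rot p d (?\<sigma> (i, r)) \<longleftrightarrow> \<sigma> (rot p 1 (\<alpha> i, r)) = rot p d (\<sigma> (\<alpha> i, r))"
      if r: "r < p" for r d
    proof -
      have \<alpha>ir: "(\<alpha> i, r) \<in> I \<times> {..<p}" using \<alpha>i r by simp
      have in': "\<sigma> (rot p 1 (\<alpha> i, r)) \<in> I' \<times> {..<p}" "rot p d (\<sigma> (\<alpha> i, r)) \<in> I' \<times> {..<p}"
        using rot_in[OF p \<alpha>ir] rot_in[OF p] bijections_in[OF \<sigma>] \<alpha>ir by blast+
      have eq: "rot p 1 (i, r) \<in> K \<times> {..<p}" "map_prod \<alpha> id (rot p 1 (i, r)) = rot p 1 (\<alpha> i, r)"
        using i r p by (auto simp: rot_def)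
      have eq2: "rot p d (map_prod \<beta> id y) = map_prod \<beta> id (rot p d y)" for y
        by (simp add: rot_def map_prod_def split_beta)
      have "inj_on (map_prod \<beta> id) (I' \<times> {..<p})"
        using \<beta> by (auto simp: bij_betw_def inj_on_def)
      then show ?thesis
        using inj_on_eq_iff[OF _ in'] eq i r by (simp add: eq2 del: One_nat_def)
    qed
    then show ?thesis using i \<alpha>i unfolding matched_def by blast
  qed
  then have b: "bij_betw \<alpha> {i \<in> K. i \<in> matched p K ?\<sigma>} {i \<in> I. i \<in> matched p I \<sigma>}"
    by (intro bij_betw_Collect[OF \<alpha>]) auto
  have "{i \<in> K. i \<in> matched p K ?\<sigma>} = matched p K ?\<sigma>"
    "{i \<in> I. i \<in> matched p I \<sigma>} = matched p I \<sigma>" by (auto simp: matched_def)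
  then show ?thesis using bij_betw_same_card[OF b] by simp
qed

lemma bij_betw_map_prod_id:
  "bij_betw \<alpha> K I \<Longrightarrow> bij_betw (map_prod \<alpha> id) (K \<times> B) (I \<times> B)"
  by (intro bij_betw_map_prod) auto

definition block_bijections :: "nat \<Rightarrow> nat \<Rightarrow> (nat \<times> nat \<Rightarrow> nat \<times> nat) set" where
  "block_bijections p k = bijections ({..<k} \<times> {..<p}) ({..<k} \<times> {..<p})"

text \<open>Brings the leftover blocks \<open>I - J\<close> and \<open>I' - J'\<close> to standard
  form; domain and codomain are relabelled independently of each other.\<close>

lemma card_bijections_reindex:
  assumes "p > 0" "finite I" "finite I'" "card I = k" "card I' = k"
  shows "card {\<sigma> \<in> bijections (I \<times> {..<p}) (I' \<times> {..<p}). Pr (card (matched p I \<sigma>))}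
    = card {\<sigma> \<in> block_bijections p k. Pr (card (matched p {..<k} \<sigma>))}"
proof -
  obtain \<alpha> where \<alpha>: "bij_betw \<alpha> {..<k} I"
    using ex_bij_betw_nat_finite[OF assms(2)] assms(4) by (auto simp: atLeast0LessThan)
  obtain \<beta> where \<beta>: "bij_betw \<beta> I' {..<k}"
    using ex_bij_betw_finite_nat[OF assms(3)] assms(5) by (auto simp: atLeast0LessThan)
  have "bij_betw (\<lambda>\<sigma>. restrict (map_prod \<beta> id \<circ> \<sigma> \<circ> map_prod \<alpha> id) ({..<k} \<times> {..<p}))
      (bijections (I \<times> {..<p}) (I' \<times> {..<p})) (block_bijections p k)"
    unfolding block_bijections_def
    by (intro bij_betw_bijections bij_betw_map_prod_id \<alpha> \<beta>)
  then have "bij_betw (\<lambda>\<sigma>. restrict (map_prod \<beta> id \<circ> \<sigma> \<circ> map_prod \<alpha> id) ({..<k} \<times> {..<p}))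
      {\<sigma> \<in> bijections (I \<times> {..<p}) (I' \<times> {..<p}). Pr (card (matched p I \<sigma>))}
      {\<sigma> \<in> block_bijections p k. Pr (card (matched p {..<k} \<sigma>))}"
    using matched_reindex[OF assms(1) \<alpha> \<beta>] by (intro bij_betw_Collect) auto
  then show ?thesis by (rule bij_betw_same_card)
qed

text \<open>Translates between two conventions outside \<open>S\<close>: \<open>permutes\<close>
  demands fixed points there, \<open>bijections\<close> the value \<open>undefined\<close>.\<close>

lemma bij_betw_restrict_permutes:
  "bij_betw (\<lambda>\<sigma>. restrict \<sigma> S) {\<sigma>. \<sigma> permutes S} (bijections S S)"
proof (rule bij_betw_byWitness[where f' = "\<lambda>\<sigma> x. if x \<in> S then \<sigma> x else x"])
  show "\<forall>\<sigma>\<in>{\<sigma>. \<sigma> permutes S}. (\<lambda>x. if x \<in> S then restrict \<sigma> S x else x) = \<sigma>"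
    by (auto simp: fun_eq_iff permutes_not_in)
  show "\<forall>\<sigma>\<in>bijections S S. restrict (\<lambda>x. if x \<in> S then \<sigma> x else x) S = \<sigma>"
    by (auto simp: fun_eq_iff bijections_def extensional_def)
  show "(\<lambda>\<sigma>. restrict \<sigma> S) ` {\<sigma>. \<sigma> permutes S} \<subseteq> bijections S S"
    by (auto simp: bijections_def permutes_imp_bij cong: bij_betw_cong)
  show "(\<lambda>\<sigma> x. if x \<in> S then \<sigma> x else x) ` bijections S S \<subseteq> {\<sigma>. \<sigma> permutes S}"
    by (auto simp: bijections_def intro!: bij_imp_permutes cong: bij_betw_cong)
qed

definition coord_perm :: "'c set \<Rightarrow> ('c \<Rightarrow> 'a) \<Rightarrow> ('a \<Rightarrow> 'a) \<Rightarrow> 'c \<Rightarrow> 'c" where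
  "coord_perm K \<phi> \<sigma> = restrict (inv_into K \<phi> \<circ> \<sigma> \<circ> \<phi>) K"

lemma bij_betw_coord_perm:
  assumes \<phi>: "bij_betw \<phi> K S"
  shows "bij_betw (coord_perm K \<phi>) {\<sigma>. \<sigma> permutes S} (bijections K K)"
proof -
  have "bij_betw ((\<lambda>\<sigma>. restrict (inv_into K \<phi> \<circ> \<sigma> \<circ> \<phi>) K) \<circ> (\<lambda>\<sigma>. restrict \<sigma> S))
      {\<sigma>. \<sigma> permutes S} (bijections K K)"
    using \<phi> by (intro bij_betw_trans[OF bij_betw_restrict_permutes] bij_betw_bijections bij_betw_inv_into)
  moreover have "((\<lambda>\<sigma>. restrict (inv_into K \<phi> \<circ> \<sigma> \<circ> \<phi>) K) \<circ> (\<lambda>\<sigma>. restrict \<sigma> S)) = coord_perm K \<phi>"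
    using bij_betwE[OF \<phi>] by (auto simp: fun_eq_iff coord_perm_def)
  ultimately show ?thesis by simp
qed

lemma card_bijections:
  assumes "finite A"
  shows "card (bijections A A) = fact (card A)"
  using bij_betw_same_card[OF bij_betw_restrict_permutes[of A]] card_permutations[OF refl assms] by simp

lemma card_block_bijections: "card (block_bijections p k) = fact (p * k)"
  by (simp add: block_bijections_def card_bijections card_cartesian_product mult.commute)

text \<open>Summing over \<open>stab_pairs\<close> amounts to summing over the functions \<open>e\<close> supported in the matched
  blocks, and a summand only depends on the number \<open>y\<close> of blocks in the support.\<close>

lemma (in block_bijection) sum_fixed_ratio:
  assumes fin: "finite I" "finite I'" and k: "card I = k" "card I' = k"
  shows "(\<Sum>(e', e)\<in>stab_pairs p I I' \<sigma>.
      real (card {\<tau> \<in> bijections (I \<times> {..<p}) (I' \<times> {..<p}). intertwines p I \<tau> e' e \<and> Pr (card (matched p I \<tau>))})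
      / real (card {\<tau> \<in> bijections (I \<times> {..<p}) (I' \<times> {..<p}). intertwines p I \<tau> e' e}))
    = (\<Sum>y\<le>k. real (card (matched p I \<sigma>) choose y) * (real p - 1) ^ y *
        (real (card {\<rho> \<in> block_bijections p (k - y). Pr (y + card (matched p {..<k - y} \<rho>))})
          / fact (p * (k - y))))"
proof -
  define R where "R y = real (card {\<rho> \<in> block_bijections p (k - y). Pr (y + card (matched p {..<k - y} \<rho>))})
          / fact (p * (k - y))" for y
  define E where "E = {e \<in> I \<rightarrow>\<^sub>E {..<p}. supp I e \<subseteq> matched p I \<sigma>}"
  have ratio: "real (card {\<tau> \<in> bijections (I \<times> {..<p}) (I' \<times> {..<p}). intertwines p I \<tau> e' e \<and> Pr (card (matched p I \<tau>))})
      / real (card {\<tau> \<in> bijections (I \<times> {..<p}) (I' \<times> {..<p}). intertwines p I \<tau> e' e}) = R (card (supp I e))"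
    if "(e', e) \<in> stab_pairs p I I' \<sigma>" for e' e
  proof -
    have ee: "intertwines p I \<sigma> e' e" "e \<in> I \<rightarrow>\<^sub>E {..<p}" "e' \<in> I' \<rightarrow>\<^sub>E {..<p}"
      using that by (auto simp: stab_pairs_def)
    define J J' where "J = supp I e" and "J' = supp I' e'"
    have sub: "J \<subseteq> I" "J' \<subseteq> I'" by (auto simp: J_def J'_def supp_def)
    have "bij_betw \<sigma> (J \<times> {..<p}) (J' \<times> {..<p})"
    proof (rule bij_betw_subset)
      show "bij_betw \<sigma> (I \<times> {..<p}) (I' \<times> {..<p})" using \<sigma> by (simp add: bijections_def)
      show "\<sigma> ` (J \<times> {..<p}) = J' \<times> {..<p}" unfolding J_def J'_def by (rule image_supp[OF ee])
    qed (use sub in blast)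
    from bij_betw_same_card[OF this] have cJ: "card J = card J'"
      using p0 by (simp add: card_cartesian_product)
    have cards: "card (I - J) = k - card J" "card (I' - J') = k - card J"
      using sub fin k cJ by (simp_all add: card_Diff_subset finite_subset)
    obtain c where c: "c > 0" "\<And>Pr. card {\<tau> \<in> bijections (I \<times> {..<p}) (I' \<times> {..<p}).
        intertwines p I \<tau> e' e \<and> Pr (card (matched p I \<tau>))}
      = c * card {\<rho> \<in> bijections ((I - J) \<times> {..<p}) ((I' - J') \<times> {..<p}).
          Pr (card J + card (matched p (I - J) \<rho>))}"
      using card_fixed[OF ee J_def J'_def fin] by blast
    have re: "card {\<rho> \<in> bijections ((I - J) \<times> {..<p}) ((I' - J') \<times> {..<p}).
          Pr (card J + card (matched p (I - J) \<rho>))}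
        = card {\<rho> \<in> block_bijections p (k - card J). Pr (card J + card (matched p {..<k - card J} \<rho>))}" for Pr
      using fin cards by (intro card_bijections_reindex[OF p0]) auto
    \<comment> \<open>The same \<open>c\<close> serves \<open>Pr\<close> and the always true
      predicate, so it cancels in the quotient; for the latter the remaining count is the factorial
      in the denominator of \<open>R\<close>.\<close>
    show ?thesis
      using c(2)[of Pr] c(2)[of "\<lambda>_. True"] c(1) re[of Pr] re[of "\<lambda>_. True"]
      by (simp add: R_def card_block_bijections J_def)
  qed
  have "(\<Sum>(e', e)\<in>stab_pairs p I I' \<sigma>.
      real (card {\<tau> \<in> bijections (I \<times> {..<p}) (I' \<times> {..<p}). intertwines p I \<tau> e' e \<and> Pr (card (matched p I \<tau>))})
      / real (card {\<tau> \<in> bijections (I \<times> {..<p}) (I' \<times> {..<p}). intertwines p I \<tau> e' e}))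
    = (\<Sum>z\<in>stab_pairs p I I' \<sigma>. R (card (supp I (snd z))))"
    using ratio by (intro sum.cong) auto
  also have "\<dots> = (\<Sum>e\<in>E. R (card (supp I e)))"
    unfolding E_def by (rule sum.reindex_bij_betw[OF bij_betw_stab_pairs])
  also have "\<dots> = (\<Sum>y\<le>k. \<Sum>e\<in>{e \<in> E. card (supp I e) = y}. R (card (supp I e)))"
  proof (rule sum.group[symmetric])
    show "finite E" using fin by (simp add: E_def finite_PiE)
    show "(\<lambda>e. card (supp I e)) ` E \<subseteq> {..k}"
      using fin k by (auto simp: supp_def intro!: card_mono)
  qed simp
  also have "\<dots> = (\<Sum>y\<le>k. real (card (matched p I \<sigma>) choose y) * (real p - 1) ^ y * R y)"
  proof (rule sum.cong[OF refl])
    fix y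
    have "(\<Sum>e\<in>{e \<in> E. card (supp I e) = y}. R (card (supp I e)))
        = real (card {e \<in> E. card (supp I e) = y}) * R y" by simp
    also have "card {e \<in> E. card (supp I e) = y} = (card (matched p I \<sigma>) choose y) * (p - 1) ^ y"
      using card_supp_subset_card[OF fin(1) matched_subset p0, of y] by (simp add: E_def conj_assoc)
    finally show "(\<Sum>e\<in>{e \<in> E. card (supp I e) = y}. R (card (supp I e)))
        = real (card (matched p I \<sigma>) choose y) * (real p - 1) ^ y * R y"
      using p0 by (simp add: of_nat_diff)
  qed
  finally show ?thesis by (simp add: R_def)
qed

section \<open>Double cosets and the Burnside kernel of a finite group\<close>

text \<open>Two subgroups are allowed, here and in \<open>mixed_double_coset\<close>, because Sylow
  conjugacy is proved by counting the cosets \<open>H x K\<close> for different \<open>H\<close> and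
  \<open>K\<close>; the Burnside kernel is the case \<open>H = K\<close>. The equation is kept free
  of inverses.\<close>

definition twisted_stab :: "('a, 'm) monoid_scheme \<Rightarrow> 'a set \<Rightarrow> 'a set \<Rightarrow> 'a \<Rightarrow> ('a \<times> 'a) set" where
  "twisted_stab G H K x = {(h, g) \<in> H \<times> K. h \<otimes>\<^bsub>G\<^esub> x = x \<otimes>\<^bsub>G\<^esub> g}"

definition mixed_double_coset :: "('a, 'm) monoid_scheme \<Rightarrow> 'a set \<Rightarrow> 'a set \<Rightarrow> 'a \<Rightarrow> 'a set" where
  "mixed_double_coset G H K x = (\<lambda>(h, g). inv\<^bsub>G\<^esub> h \<otimes>\<^bsub>G\<^esub> x \<otimes>\<^bsub>G\<^esub> g) ` (H \<times> K)"

context group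
begin

lemma twist_eq_iff:
  assumes "h \<in> carrier G" "g \<in> carrier G" "x \<in> carrier G" "y \<in> carrier G"
  shows "inv h \<otimes> x \<otimes> g = y \<longleftrightarrow> x \<otimes> g = h \<otimes> y"
  using assms by (metis inv_closed inv_solve_left m_assoc m_closed)

lemma mixed_double_coset_eq:
  assumes H: "subgroup H G" and K: "subgroup K G" and x: "x \<in> carrier G"
  shows "mixed_double_coset G H K x = {y \<in> carrier G. \<exists>h\<in>H. \<exists>g\<in>K. x \<otimes> g = h \<otimes> y}"
proof -
  have c: "\<And>h. h \<in> H \<Longrightarrow> h \<in> carrier G" "\<And>g. g \<in> K \<Longrightarrow> g \<in> carrier G"
    using H K by (auto dest: subgroup.mem_carrier)
  show ?thesis
  proof (intro equalityI subsetI)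
    fix y assume "y \<in> mixed_double_coset G H K x"
    then obtain h g where hg: "h \<in> H" "g \<in> K" and y: "y = inv h \<otimes> x \<otimes> g"
      unfolding mixed_double_coset_def by auto
    then have "y \<in> carrier G" using x c by simp
    moreover have "x \<otimes> g = h \<otimes> y" using twist_eq_iff[of h g x y] hg y x c by simp
    ultimately show "y \<in> {y \<in> carrier G. \<exists>h\<in>H. \<exists>g\<in>K. x \<otimes> g = h \<otimes> y}" using hg by auto
  next
    fix y assume "y \<in> {y \<in> carrier G. \<exists>h\<in>H. \<exists>g\<in>K. x \<otimes> g = h \<otimes> y}"
    then obtain h g where y: "y \<in> carrier G" and hg: "h \<in> H" "g \<in> K" "x \<otimes> g = h \<otimes> y" by auto
    then have "y = inv h \<otimes> x \<otimes> g" using twist_eq_iff[of h g x y] x c by simp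
    then show "y \<in> mixed_double_coset G H K x" using hg unfolding mixed_double_coset_def by force
  qed
qed

text \<open>Inversion permutes \<open>H\<close>, so it does not matter whether \<open>h\<close> or
  its inverse acts on the left.\<close>

lemma double_coset_eq:
  assumes H: "subgroup H G" and x: "x \<in> carrier G"
  shows "double_coset G H x = mixed_double_coset G H H x"
proof -
  have "inv h \<in> H" if "h \<in> H" for h using H that by (rule subgroup.m_inv_closed)
  moreover have "h = inv (inv h)" if "h \<in> H" for h
    using that H by (simp add: subgroup.mem_carrier)
  ultimately show ?thesis
    unfolding double_coset_def mixed_double_coset_def r_coset_def set_mult_def
    by (auto simp: image_iff) metis+
qed

lemma self_in_mixed_double_coset:
  assumes "subgroup H G" "subgroup K G" "x \<in> carrier G"
  shows "x \<in> mixed_double_coset G H K x"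
  using assms by (auto simp: mixed_double_coset_eq intro!: bexI[of _ \<one>] subgroup.one_closed)

lemma mixed_double_coset_absorb:
  assumes H: "subgroup H G" and K: "subgroup K G" and x: "x \<in> carrier G"
    and y: "y \<in> mixed_double_coset G H K x"
  shows "mixed_double_coset G H K y = mixed_double_coset G H K x"
proof -
  have c: "\<And>h. h \<in> H \<Longrightarrow> h \<in> carrier G" "\<And>g. g \<in> K \<Longrightarrow> g \<in> carrier G"
    using H K by (auto dest: subgroup.mem_carrier)
  have sub: "mixed_double_coset G H K y \<subseteq> mixed_double_coset G H K x"
    if x: "x \<in> carrier G" and y: "y \<in> mixed_double_coset G H K x" for x y
  proof
    fix z assume z: "z \<in> mixed_double_coset G H K y"
    from y obtain h g where yy: "y \<in> carrier G" "h \<in> H" "g \<in> K" "x \<otimes> g = h \<otimes> y"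
      using mixed_double_coset_eq[OF H K x] by auto
    from z obtain h' g' where zz: "z \<in> carrier G" "h' \<in> H" "g' \<in> K" "y \<otimes> g' = h' \<otimes> z"
      using mixed_double_coset_eq[OF H K yy(1)] by auto
    have "x \<otimes> (g \<otimes> g') = h \<otimes> (y \<otimes> g')"
      using yy zz x c by (metis m_assoc)
    also have "\<dots> = (h \<otimes> h') \<otimes> z" using yy zz x c by (metis m_assoc)
    finally have "x \<otimes> (g \<otimes> g') = (h \<otimes> h') \<otimes> z" .
    moreover have "g \<otimes> g' \<in> K" "h \<otimes> h' \<in> H"
      using yy zz H K by (auto intro: subgroup.m_closed)
    ultimately show "z \<in> mixed_double_coset G H K x"
      using zz(1) mixed_double_coset_eq[OF H K x] by blast
  qed
  from y obtain h g where yy: "y \<in> carrier G" "h \<in> H" "g \<in> K" "x \<otimes> g = h \<otimes> y"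
    using mixed_double_coset_eq[OF H K x] by auto
  have "y \<otimes> inv g = inv h \<otimes> x"
    using yy x c by (metis inv_closed inv_solve_left inv_solve_right m_assoc m_closed)
  moreover have "inv g \<in> K" "inv h \<in> H"
    using yy H K by (auto intro: subgroup.m_inv_closed)
  ultimately have "x \<in> mixed_double_coset G H K y"
    using x mixed_double_coset_eq[OF H K yy(1)] by blast
  then show ?thesis using sub[OF x y] sub[OF yy(1), of x] by blast
qed

lemma disjoint_mixed_double_cosets:
  assumes H: "subgroup H G" and K: "subgroup K G"
  shows "disjoint (mixed_double_coset G H K ` carrier G)"
  unfolding disjoint_def using mixed_double_coset_absorb[OF H K] by blast

lemma Union_mixed_double_cosets:
  assumes H: "subgroup H G" and K: "subgroup K G"
  shows "\<Union> (mixed_double_coset G H K ` carrier G) = carrier G"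
  using self_in_mixed_double_coset[OF H K] mixed_double_coset_eq[OF H K] by auto

text \<open>Orbit-stabilizer: the fibres \<open>F y\<close> of the orbit map partition
  \<open>H \<times> K\<close>, and each is the right translate of the stabilizer by any one of its
  members \<open>(h0, g0)\<close>.\<close>

lemma card_mixed_double_coset:
  assumes H: "subgroup H G" and K: "subgroup K G" and x: "x \<in> carrier G"
    and fin: "finite H" "finite K"
  shows "card (mixed_double_coset G H K x) * card (twisted_stab G H K x) = card H * card K"
proof -
  have c: "\<And>h. h \<in> H \<Longrightarrow> h \<in> carrier G" "\<And>g. g \<in> K \<Longrightarrow> g \<in> carrier G"
    using H K by (auto dest: subgroup.mem_carrier)
  define F where "F y = {(h, g) \<in> H \<times> K. x \<otimes> g = h \<otimes> y}" for y
  have "card (F y) = card (twisted_stab G H K x)" if y: "y \<in> mixed_double_coset G H K x" for y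
  proof -
    from y obtain h0 g0 where yy: "y \<in> carrier G" "h0 \<in> H" "g0 \<in> K" "x \<otimes> g0 = h0 \<otimes> y"
      using mixed_double_coset_eq[OF H K x] by auto
    have eq: "x \<otimes> (g \<otimes> g0) = (h \<otimes> h0) \<otimes> y \<longleftrightarrow> h \<otimes> x = x \<otimes> g" if "h \<in> H" "g \<in> K" for h g
    proof -
      have "(h \<otimes> h0) \<otimes> y = (h \<otimes> x) \<otimes> g0" using yy that c x by (simp add: m_assoc)
      moreover have "x \<otimes> (g \<otimes> g0) = (x \<otimes> g) \<otimes> g0" using yy that c x by (simp add: m_assoc)
      ultimately show ?thesis using yy that c x by auto
    qed
    have "bij_betw (\<lambda>(h, g). (h \<otimes> h0, g \<otimes> g0)) (twisted_stab G H K x) (F y)"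
    proof (rule bij_betw_byWitness[where f' = "\<lambda>(h, g). (h \<otimes> inv h0, g \<otimes> inv g0)"])
      show "(\<lambda>(h, g). (h \<otimes> h0, g \<otimes> g0)) ` twisted_stab G H K x \<subseteq> F y"
        using eq yy H K by (auto simp: twisted_stab_def F_def intro: subgroup.m_closed)
      show "(\<lambda>(h, g). (h \<otimes> inv h0, g \<otimes> inv g0)) ` F y \<subseteq> twisted_stab G H K x"
      proof clarify
        fix h g assume "(h, g) \<in> F y"
        then have hg: "h \<in> H" "g \<in> K" "x \<otimes> g = h \<otimes> y" by (auto simp: F_def)
        have 1: "h \<otimes> inv h0 \<in> H" "g \<otimes> inv g0 \<in> K"
          using hg yy H K by (auto intro!: subgroup.m_closed subgroup.m_inv_closed)
        have "(h \<otimes> inv h0) \<otimes> h0 = h" "(g \<otimes> inv g0) \<otimes> g0 = g"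
          using hg yy c by (auto simp: m_assoc)
        then show "(h \<otimes> inv h0, g \<otimes> inv g0) \<in> twisted_stab G H K x"
          using eq[OF 1] 1 hg by (auto simp: twisted_stab_def)
      qed
    qed (use yy c in \<open>auto simp: twisted_stab_def F_def m_assoc\<close>)
    then show ?thesis by (simp add: bij_betw_same_card)
  qed
  then have "(\<Sum>y\<in>mixed_double_coset G H K x. card (F y))
      = card (mixed_double_coset G H K x) * card (twisted_stab G H K x)" by simp
  moreover have "(\<Sum>y\<in>mixed_double_coset G H K x. card (F y))
      = card (\<Union>y\<in>mixed_double_coset G H K x. F y)"
  proof (rule card_UN_disjoint[symmetric])
    show "finite (mixed_double_coset G H K x)" using fin by (simp add: mixed_double_coset_def)
    show "\<forall>y\<in>mixed_double_coset G H K x. finite (F y)"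
      using fin by (auto simp: F_def intro: finite_subset[of _ "H \<times> K"])
    show "\<forall>y\<in>mixed_double_coset G H K x. \<forall>z\<in>mixed_double_coset G H K x. y \<noteq> z \<longrightarrow> F y \<inter> F z = {}"
      using c mixed_double_coset_eq[OF H K x] by (auto simp: F_def)
  qed
  moreover have "(\<Union>y\<in>mixed_double_coset G H K x. F y) = H \<times> K"
  proof -
    have "(h, g) \<in> F (inv h \<otimes> x \<otimes> g)" if "h \<in> H" "g \<in> K" for h g
      using that c x twist_eq_iff[of h g x "inv h \<otimes> x \<otimes> g"] by (auto simp: F_def)
    then show ?thesis unfolding mixed_double_coset_def by (auto simp: F_def image_iff)
  qed
  ultimately show ?thesis by (simp add: card_cartesian_product)
qed

section \<open>Conjugacy of Sylow subgroups\<close>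

text \<open>The sets \<open>H x K\<close> partition the group, so the size of one of them is not
  divisible by \<open>p ^ Suc n\<close>. By orbit-stabilizer this size is a power of
  \<open>p\<close>, hence at most \<open>p ^ n\<close>, and the stabilizer has at least
  \<open>p ^ n\<close> elements. As it projects injectively to \<open>H\<close>, it projects onto
  \<open>H\<close>, which says that every \<open>h\<close> equals \<open>x g\<close> times the
  inverse of \<open>x\<close> for some \<open>g\<close> in \<open>K\<close>.\<close>

lemma sylow_conjugate:
  assumes fin: "finite (carrier G)" and p: "prime (p::nat)"
    and H: "subgroup H G" and K: "subgroup K G"
    and cH: "card H = p ^ n" and cK: "card K = p ^ n" and n: "\<not> p ^ Suc n dvd order G"
  obtains x where "x \<in> carrier G" "H = (\<lambda>g. x \<otimes> g \<otimes> inv x) ` K"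
proof -
  have c: "\<And>h. h \<in> H \<Longrightarrow> h \<in> carrier G" "\<And>g. g \<in> K \<Longrightarrow> g \<in> carrier G"
    using H K by (auto dest: subgroup.mem_carrier)
  have fH: "finite H" "finite K"
    using H K fin by (meson finite_subset subgroup.subset)+
  have "order G = (\<Sum>D\<in>mixed_double_coset G H K ` carrier G. card D)"
    unfolding order_def
    using card_Union_disjoint[OF disjoint_mixed_double_cosets[OF H K]] Union_mixed_double_cosets[OF H K] fin
    by (metis (no_types, lifting) Union_upper finite_subset)
  with n obtain x where x: "x \<in> carrier G" and nd: "\<not> p ^ Suc n dvd card (mixed_double_coset G H K x)"
    by (metis (no_types, lifting) dvd_sum imageE)
  define s where "s = card (twisted_stab G H K x)"
  have prod: "card (mixed_double_coset G H K x) * s = p ^ n * p ^ n"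
    using card_mixed_double_coset[OF H K x fH] by (simp add: s_def cH cK)
  have "s dvd p ^ (n + n)" using prod by (metis dvd_triv_right power_add)
  then obtain j where j: "s = p ^ j" "j \<le> n + n" using p divides_primepow_nat by blast
  have cd: "card (mixed_double_coset G H K x) = p ^ (n + n - j)"
  proof -
    have "card (mixed_double_coset G H K x) * p ^ j = p ^ (n + n - j) * p ^ j"
      using prod j by (simp flip: power_add)
    then show ?thesis using p by (simp add: prime_gt_0_nat)
  qed
  have "j \<ge> n"
  proof (rule ccontr)
    assume "\<not> n \<le> j"
    then have "Suc n \<le> n + n - j" by simp
    then show False using nd cd le_imp_power_dvd by metis
  qed
  then have sn: "p ^ n \<le> s" using j p by (metis power_increasing prime_ge_1_nat)
  have inj: "inj_on fst (twisted_stab G H K x)"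
    using x c by (auto simp: inj_on_def twisted_stab_def)
  have sub: "fst ` twisted_stab G H K x \<subseteq> H" by (auto simp: twisted_stab_def)
  have "card (fst ` twisted_stab G H K x) = s" using inj by (simp add: card_image s_def)
  then have all: "fst ` twisted_stab G H K x = H"
    using sub fH sn cH by (metis card_mono card_subset_eq le_antisym)
  have "H \<subseteq> (\<lambda>g. x \<otimes> g \<otimes> inv x) ` K"
  proof
    fix h assume "h \<in> H"
    then obtain g where g: "(h, g) \<in> twisted_stab G H K x" using all by force
    then have "h \<in> H" "g \<in> K" "h \<otimes> x = x \<otimes> g" by (auto simp: twisted_stab_def)
    then have "h = x \<otimes> g \<otimes> inv x" using x c by (metis inv_solve_right m_closed)
    then show "h \<in> (\<lambda>g. x \<otimes> g \<otimes> inv x) ` K" using \<open>g \<in> K\<close> by auto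
  qed
  moreover have "card ((\<lambda>g. x \<otimes> g \<otimes> inv x) ` K) \<le> card H"
    using card_image_le[OF fH(2)] cH cK by metis
  ultimately have "H = (\<lambda>g. x \<otimes> g \<otimes> inv x) ` K"
    using fH by (metis card_seteq finite_imageI)
  then show ?thesis using that x by blast
qed

section \<open>The Burnside kernel of a finite group\<close>

lemma twist_stabilizer_eq:
  assumes "subgroup H G" "x \<in> carrier G"
  shows "twist_stabilizer G H x = twisted_stab G H H x"
  using assms
  by (auto simp: twist_stabilizer_def stabilizer_def twisted_stab_def twist_def twist_eq_iff subgroup.mem_carrier)

lemma finite_twisted_stab:
  "finite H \<Longrightarrow> finite K \<Longrightarrow> finite (twisted_stab G H K x)"
  by (rule finite_subset[of _ "H \<times> K"]) (auto simp: twisted_stab_def)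

lemma card_twisted_stab_pos:
  assumes "subgroup H G" "subgroup K G" "x \<in> carrier G" "finite H" "finite K"
  shows "card (twisted_stab G H K x) > 0"
proof -
  have "(\<one>, \<one>) \<in> twisted_stab G H K x"
    using assms by (auto simp: twisted_stab_def subgroup.one_closed)
  then show ?thesis using finite_twisted_stab[OF assms(4,5)] card_gt_0_iff by blast
qed

lemma mem_invariants_twist:
  assumes "subgroup H G" "(h, g) \<in> H \<times> H"
  shows "x \<in> invariants (carrier G) (twist G) (h, g)
    \<longleftrightarrow> x \<in> carrier G \<and> (h, g) \<in> twisted_stab G H H x"
  using assms
  by (auto simp: invariants_def twisted_stab_def twist_def twist_eq_iff subgroup.mem_carrier)

text \<open>One step draws a uniform pair from the stabilizer of \<open>x\<close> and then a uniform
  fixed point of that pair. Exchanging the sums, the mass of \<open>B\<close> is the average over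
  pairs of the proportion of fixed points that lie in \<open>B\<close>.\<close>

lemma sum_burnside_kernel:
  assumes fin: "finite (carrier G)" and H: "subgroup H G" and x: "x \<in> carrier G"
    and B: "B \<subseteq> carrier G"
  shows "(\<Sum>y\<in>B. burnside_kernel G H x y) = 1 / real (card (twisted_stab G H H x)) *
    (\<Sum>hg\<in>twisted_stab G H H x. real (card {y \<in> B. hg \<in> twisted_stab G H H y})
       / real (card {y \<in> carrier G. hg \<in> twisted_stab G H H y}))"
proof -
  define St where "St = twisted_stab G H H"
  have fH: "finite H" using H fin by (meson finite_subset subgroup.subset)
  have fS: "finite (St x)" using fH by (simp add: St_def finite_twisted_stab)
  have inv: "invariants (carrier G) (twist G) a = {y \<in> carrier G. a \<in> St y}" if "a \<in> St x" for a
    using that mem_invariants_twist[OF H, of "fst a" "snd a"]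
    by (auto simp: St_def twisted_stab_def)
  have eq: "burnside_kernel G H x y = 1 / real (card (St x)) *
      (\<Sum>a\<in>St x. if a \<in> St y then 1 / real (card {y \<in> carrier G. a \<in> St y}) else 0)"
    if "y \<in> B" for y
    using that B fS twist_stabilizer_eq[OF H x] twist_stabilizer_eq[OF H, of y]
    by (auto simp: burnside_kernel_def inv sum.inter_restrict simp flip: St_def)
  have "(\<Sum>y\<in>B. burnside_kernel G H x y) = 1 / real (card (St x)) * (\<Sum>a\<in>St x.
      \<Sum>y\<in>B. if a \<in> St y then 1 / real (card {y \<in> carrier G. a \<in> St y}) else 0)"
    by (simp only: eq sum_distrib_left[symmetric] sum.swap[of _ B] cong: sum.cong)
  moreover have "(\<Sum>y\<in>B. if a \<in> St y then 1 / real (card {y \<in> carrier G. a \<in> St y}) else 0)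
      = real (card {y \<in> B. a \<in> St y}) / real (card {y \<in> carrier G. a \<in> St y})" for a
    using finite_subset[OF B fin]
    by (simp add: sum.inter_filter[symmetric])
  ultimately show ?thesis by (simp add: St_def)
qed

lemma burnside_kernel_row_sum:
  assumes fin: "finite (carrier G)" and H: "subgroup H G" and x: "x \<in> carrier G"
  shows "(\<Sum>y\<in>carrier G. burnside_kernel G H x y) = 1"
proof -
  have fH: "finite H" using H fin by (meson finite_subset subgroup.subset)
  \<comment> \<open>The pair \<open>a\<close> fixes \<open>x\<close>, so the quotient is 1 and not
    the default value 0 of a division by 0.\<close>
  have "real (card {y \<in> carrier G. a \<in> twisted_stab G H H y})
      / real (card {y \<in> carrier G. a \<in> twisted_stab G H H y}) = 1" if "a \<in> twisted_stab G H H x" for a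
    using that fin x by (auto simp: card_eq_0_iff)
  then show ?thesis using card_twisted_stab_pos[OF H H x fH fH]
    by (simp add: sum_burnside_kernel[OF fin H x order_refl] del: divide_self_if cong: sum.cong)
qed

text \<open>The identity pair lies in every stabilizer and contributes a positive summand, so any
  state reaches any other in one step.\<close>

lemma burnside_kernel_pos:
  assumes fin: "finite (carrier G)" and H: "subgroup H G" and x: "x \<in> carrier G"
    and y: "y \<in> carrier G"
  shows "burnside_kernel G H x y > 0"
proof -
  have fH: "finite H" using H fin by (meson finite_subset subgroup.subset)
  have mem: "(\<one>, \<one>) \<in> twisted_stab G H H x \<inter> twisted_stab G H H y"
    using H x y by (auto simp: twisted_stab_def subgroup.one_closed)
  have "card (invariants (carrier G) (twist G) (\<one>, \<one>)) > 0"
    using mem fin x H mem_invariants_twist[OF H, of \<one> \<one>]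
    by (auto simp: card_gt_0_iff invariants_def twisted_stab_def)
  then have "(\<Sum>hg\<in>twisted_stab G H H x \<inter> twisted_stab G H H y.
      1 / real (card (invariants (carrier G) (twist G) hg))) > 0"
    using mem fH finite_twisted_stab[of H H]
    by (intro sum_pos2[of _ "(\<one>, \<one>)"]) auto
  then show ?thesis using card_twisted_stab_pos[OF H H x fH fH]
    by (simp add: burnside_kernel_def twist_stabilizer_eq[OF H] x y)
qed

text \<open>By orbit-stabilizer, the weight of \<open>x\<close> times the factor in front of the
  kernel is \<open>1 / card H ^ 2\<close> for every \<open>x\<close>; the remaining sum runs over an
  intersection that is symmetric in \<open>x\<close> and \<open>y\<close>.\<close>

lemma burnside_kernel_reversible:
  assumes fin: "finite (carrier G)" and H: "subgroup H G" and x: "x \<in> carrier G"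
    and y: "y \<in> carrier G"
  shows "1 / real (card (double_coset G H x)) * burnside_kernel G H x y
    = 1 / real (card (double_coset G H y)) * burnside_kernel G H y x"
proof -
  have fH: "finite H" using H fin by (meson finite_subset subgroup.subset)
  have "1 / real (card (double_coset G H z)) * (1 / real (card (twisted_stab G H H z)))
      = 1 / (real (card H) * real (card H))" if "z \<in> carrier G" for z
    using card_mixed_double_coset[OF H H that fH fH] double_coset_eq[OF H that]
    by (metis divide_divide_eq_left mult.right_neutral of_nat_mult times_divide_eq_right)
  then show ?thesis using x y
    unfolding burnside_kernel_def mult.assoc[symmetric]
    by (simp add: twist_stabilizer_eq[OF H] Int_commute)
qed

text \<open>Stated over a semiring because it is applied both to count permutations in
  \<open>nat\<close> and to sum a real density.\<close>

lemma sum_over_double_cosets: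
  fixes F :: "'a set \<Rightarrow> 'c::comm_semiring_1"
  assumes fin: "finite (carrier G)" and H: "subgroup H G"
  shows "(\<Sum>x\<in>carrier G. F (double_coset G H x)) = (\<Sum>D\<in>double_cosets G H. of_nat (card D) * F D)"
proof -
  have eq: "double_coset G H x = mixed_double_coset G H H x" if "x \<in> carrier G" for x
    using double_coset_eq[OF H that] .
  have dcs: "double_cosets G H = mixed_double_coset G H H ` carrier G"
    unfolding double_cosets_def using eq by auto
  have "(\<Sum>x\<in>\<Union>(double_cosets G H). F (double_coset G H x))
      = (\<Sum>D\<in>double_cosets G H. \<Sum>x\<in>D. F (double_coset G H x))"
  proof (subst sum.Union_disjoint)
    show "\<forall>A\<in>double_cosets G H. finite A"
      using fin by (auto simp: dcs mixed_double_coset_eq[OF H H])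
    show "\<forall>A\<in>double_cosets G H. \<forall>B\<in>double_cosets G H. A \<noteq> B \<longrightarrow> A \<inter> B = {}"
      using disjoint_mixed_double_cosets[OF H H] by (auto simp: dcs disjoint_def)
  qed auto
  also have "\<dots> = (\<Sum>D\<in>double_cosets G H. of_nat (card D) * F D)"
  proof (rule sum.cong[OF refl])
    fix D assume "D \<in> double_cosets G H"
    then obtain x where x: "x \<in> carrier G" "D = mixed_double_coset G H H x" by (auto simp: dcs)
    have "double_coset G H y = D" if "y \<in> D" for y
      using that x mixed_double_coset_absorb[OF H H x(1)] mixed_double_coset_eq[OF H H x(1)] eq by auto
    then show "(\<Sum>x\<in>D. F (double_coset G H x)) = of_nat (card D) * F D" by simp
  qed
  finally show ?thesis using Union_mixed_double_cosets[OF H H] by (simp add: dcs)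
qed

end

section \<open>Reversible kernels and lumping\<close>

lemma reversible_stationary_distribution:
  assumes "finite S" and P: "transition_kernel S P"
    and rev: "\<And>x y. x \<in> S \<Longrightarrow> y \<in> S \<Longrightarrow> \<mu> x * P x y = \<mu> y * P y x"
    and "\<And>x. x \<in> S \<Longrightarrow> 0 \<le> \<mu> x" "sum \<mu> S = 1"
  shows "stationary_distribution S P \<mu>"
  unfolding stationary_distribution_def
proof (intro conjI ballI)
  fix y assume y: "y \<in> S"
  have "(\<Sum>x\<in>S. \<mu> x * P x y) = (\<Sum>x\<in>S. \<mu> y * P y x)" using rev y by (intro sum.cong) auto
  also have "\<dots> = \<mu> y" using P y by (simp add: transition_kernel_def flip: sum_distrib_left)
  finally show "(\<Sum>x\<in>S. \<mu> x * P x y) = \<mu> y" .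
qed (use assms in auto)

text \<open>By reversibility the density \<open>\<pi> / \<mu>\<close> is harmonic for \<open>P\<close>, hence constant by the maximum
  principle.\<close>

lemma stationary_distribution_unique:
  assumes fin: "finite S" and P: "transition_kernel S P"
    and pos: "\<And>x y. x \<in> S \<Longrightarrow> y \<in> S \<Longrightarrow> 0 < P x y"
    and rev: "\<And>x y. x \<in> S \<Longrightarrow> y \<in> S \<Longrightarrow> \<mu> x * P x y = \<mu> y * P y x"
    and \<mu>: "\<And>x. x \<in> S \<Longrightarrow> 0 < \<mu> x" "sum \<mu> S = 1"
    and \<pi>: "stationary_distribution S P \<pi>" and x: "x \<in> S"
  shows "\<pi> x = \<mu> x"
proof -
  define h where "h y = \<pi> y / \<mu> y" for y
  have h: "\<pi> y = \<mu> y * h y" if "y \<in> S" for y using \<mu>(1)[OF that] by (simp add: h_def)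
  have harm: "(\<Sum>z\<in>S. P y z * h z) = h y" if y: "y \<in> S" for y
  proof -
    have "\<mu> y * (\<Sum>z\<in>S. P y z * h z) = (\<Sum>z\<in>S. \<pi> z * P z y)"
      unfolding sum_distrib_left
    proof (rule sum.cong[OF refl])
      fix z assume z: "z \<in> S"
      have "\<mu> y * (P y z * h z) = (\<mu> y * P y z) * h z" by (simp only: mult.assoc)
      also have "\<dots> = (\<mu> z * P z y) * h z" using rev[OF y z] by (simp only:)
      also have "\<dots> = \<pi> z * P z y" using h[OF z] by (simp only: mult_ac)
      finally show "\<mu> y * (P y z * h z) = \<pi> z * P z y" .
    qed
    also have "\<dots> = \<mu> y * h y" using \<pi> y h by (simp add: stationary_distribution_def)
    finally show ?thesis using \<mu>(1)[OF y] by simp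
  qed
  define m where "m = Max (h ` S)"
  have "m \<in> h ` S" unfolding m_def using fin x by (intro Max_in) auto
  then obtain y where y: "y \<in> S" "h y = m" by auto
  have le: "h z \<le> m" if "z \<in> S" for z using fin that by (simp add: m_def)
  \<comment> \<open>At a maximum \<open>y\<close> the average of the nonnegative values
    \<open>m - h z\<close> with weights \<open>P y z\<close> vanishes. All weights are positive, so
    each of these values is 0.\<close>
  have "(\<Sum>z\<in>S. P y z * (m - h z)) = m * (\<Sum>z\<in>S. P y z) - (\<Sum>z\<in>S. P y z * h z)"
    by (simp add: sum_subtractf sum_distrib_left algebra_simps)
  also have "\<dots> = 0" using harm[OF y(1)] y P by (simp add: transition_kernel_def)
  finally have "\<forall>z\<in>S. P y z * (m - h z) = 0"
    using fin le pos[OF y(1)] by (subst (asm) sum_nonneg_eq_0_iff) (auto simp: less_imp_le)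
  then have const: "h z = m" if "z \<in> S" for z using that pos[OF y(1) that] by auto
  have "1 = sum \<pi> S" using \<pi> by (simp add: stationary_distribution_def)
  also have "\<dots> = (\<Sum>z\<in>S. \<mu> z) * m" using h const by (simp add: sum_distrib_right cong: sum.cong)
  finally show ?thesis using h[OF x] const[OF x] \<mu>(2) by simp
qed

section \<open>The image process of a chain with constant fibre masses\<close>

text \<open>An event about the past of the image process is a disjoint union of histories of
  \<open>X\<close>. Each history enters the fibre over \<open>b\<close> with the same probability
  \<open>Q (y t) b\<close>, because the fibre mass depends only on the image of its last state; this
  factor can be taken out of the sum.\<close>

lemma fibre_mass_lumps:
  assumes MC: "markov_chain M S P X" and fin: "finite S" and T: "T \<in> S \<rightarrow> Y"
    and Q: "transition_kernel Y Q"
    and fib: "\<And>x b. x \<in> S \<Longrightarrow> b \<in> Y \<Longrightarrow> fibre_mass S T (P x) b = Q (T x) b"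
  shows "markov_chain M Y Q (\<lambda>t \<omega>. T (X t \<omega>))"
proof -
  interpret prob_space M using MC by (simp add: markov_chain_def)
  have X[measurable]: "X t \<in> measurable M (count_space S)" for t
    using MC by (simp add: markov_chain_def)
  have XS: "X t \<omega> \<in> S" if "\<omega> \<in> space M" for t \<omega>
    using measurable_space[OF X that] by simp
  \<comment> \<open>The product form of the Markov property also covers histories of probability 0,
    about which \<open>markov_chain\<close> asserts nothing; those occur in the sums below.\<close>
  have step: "\<P>(\<omega> in M. X (Suc t) \<omega> = s \<and> (\<forall>i\<le>t. X i \<omega> = x i))
      = \<P>(\<omega> in M. \<forall>i\<le>t. X i \<omega> = x i) * P (x t) s"
    if x: "\<And>i. i \<le> t \<Longrightarrow> x i \<in> S" and s: "s \<in> S" for t x s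
  proof (cases "\<P>(\<omega> in M. \<forall>i\<le>t. X i \<omega> = x i) = 0")
    case True
    have "\<P>(\<omega> in M. X (Suc t) \<omega> = s \<and> (\<forall>i\<le>t. X i \<omega> = x i)) \<le> \<P>(\<omega> in M. \<forall>i\<le>t. X i \<omega> = x i)"
      by (intro finite_measure_mono) auto
    then show ?thesis using True by (simp add: measure_le_0_iff)
  next
    case False
    define x' where "x' = x(Suc t := s)"
    have eq: "(\<forall>i\<le>t. X i \<omega> = x' i) \<longleftrightarrow> (\<forall>i\<le>t. X i \<omega> = x i)" for \<omega> by (simp add: x'_def)
    have "cond_prob M (\<lambda>\<omega>. X (Suc t) \<omega> = x' (Suc t)) (\<lambda>\<omega>. \<forall>i\<le>t. X i \<omega> = x' i) = P (x' t) (x' (Suc t))"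
    proof -
      have "\<forall>i\<le>Suc t. x' i \<in> S" using x s by (auto simp: x'_def)
      moreover have "\<P>(\<omega> in M. \<forall>i\<le>t. X i \<omega> = x' i) \<noteq> 0" using False by (simp only: eq not_False_eq_True)
      ultimately show ?thesis using MC unfolding markov_chain_def by blast
    qed
    then show ?thesis using False unfolding eq cond_prob_def by (simp add: x'_def field_simps)
  qed
  have main: "\<P>(\<omega> in M. T (X (Suc t) \<omega>) = b \<and> (\<forall>i\<le>t. T (X i \<omega>) = y i))
      = Q (y t) b * \<P>(\<omega> in M. \<forall>i\<le>t. T (X i \<omega>) = y i)" if b: "b \<in> Y" for t y b
  proof -
    \<comment> \<open>Histories are extensional on \<open>{..t}\<close>: this makes them finitely
      many, and distinct histories give disjoint events.\<close>
    define Hs where "Hs = {x \<in> {..t} \<rightarrow>\<^sub>E S. \<forall>i\<le>t. T (x i) = y i}"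
    have finHs: "finite Hs" unfolding Hs_def using fin by (simp add: finite_PiE)
    define E where "E x = {\<omega> \<in> space M. \<forall>i\<le>t. X i \<omega> = x i}" for x
    define F where "F x s = {\<omega> \<in> space M. X (Suc t) \<omega> = s \<and> (\<forall>i\<le>t. X i \<omega> = x i)}" for x s
    have hist: "(\<lambda>i\<in>{..t}. X i \<omega>) \<in> Hs" if "\<omega> \<in> space M" "\<forall>i\<le>t. T (X i \<omega>) = y i" for \<omega>
      using that XS by (auto simp: Hs_def)
    have dis: "x = x'" if "x \<in> Hs" "x' \<in> Hs" "\<omega> \<in> E x" "\<omega> \<in> E x'" for x x' \<omega>
      using that unfolding Hs_def E_def
      by (intro PiE_ext[of x "{..t}" "\<lambda>_. S" x']) auto
    have FE: "F x s \<subseteq> E x" for x s by (auto simp: F_def E_def)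
    have mE: "E x \<in> sets M" for x unfolding E_def by measurable
    have mF: "F x s \<in> sets M" for x s unfolding F_def by measurable
    have djE: "disjoint_family_on E Hs"
      unfolding disjoint_family_on_def
    proof (intro ballI impI equals0I)
      fix x x' \<omega> assume "x \<in> Hs" "x' \<in> Hs" "x \<noteq> x'" "\<omega> \<in> E x \<inter> E x'"
      then show False using dis[of x x' \<omega>] by simp
    qed
    have djF: "disjoint_family_on (\<lambda>(x, s). F x s) (Hs \<times> {s \<in> S. T s = b})"
      unfolding disjoint_family_on_def
    proof (intro ballI impI equals0I)
      fix a a' \<omega>
      assume a: "a \<in> Hs \<times> {s \<in> S. T s = b}" "a' \<in> Hs \<times> {s \<in> S. T s = b}" "a \<noteq> a'"
        and \<omega>: "\<omega> \<in> (case a of (x, s) \<Rightarrow> F x s) \<inter> (case a' of (x, s) \<Rightarrow> F x s)"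
      have "\<omega> \<in> F (fst a) (snd a)" "\<omega> \<in> F (fst a') (snd a')" using \<omega> by (auto simp: split_beta)
      moreover from this have "fst a = fst a'" using dis[of "fst a" "fst a'" \<omega>] FE a by (auto simp: mem_Times_iff subset_iff)
      ultimately show False using a by (auto simp: F_def prod_eq_iff)
    qed
    have "{\<omega> \<in> space M. \<forall>i\<le>t. T (X i \<omega>) = y i} = (\<Union>x\<in>Hs. E x)"
    proof (intro equalityI subsetI)
      fix \<omega> assume "\<omega> \<in> {\<omega> \<in> space M. \<forall>i\<le>t. T (X i \<omega>) = y i}"
      then show "\<omega> \<in> (\<Union>x\<in>Hs. E x)"
        using hist by (intro UN_I[of "\<lambda>i\<in>{..t}. X i \<omega>"]) (auto simp: E_def)
    qed (auto simp: E_def Hs_def)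
    then have pE: "\<P>(\<omega> in M. \<forall>i\<le>t. T (X i \<omega>) = y i) = (\<Sum>x\<in>Hs. prob (E x))"
      using finHs mE djE by (simp add: finite_measure_finite_Union image_subset_iff)
    have "{\<omega> \<in> space M. T (X (Suc t) \<omega>) = b \<and> (\<forall>i\<le>t. T (X i \<omega>) = y i)}
        = (\<Union>(x, s)\<in>Hs \<times> {s\<in>S. T s = b}. F x s)"
    proof (intro equalityI subsetI)
      fix \<omega> assume "\<omega> \<in> {\<omega> \<in> space M. T (X (Suc t) \<omega>) = b \<and> (\<forall>i\<le>t. T (X i \<omega>) = y i)}"
      then show "\<omega> \<in> (\<Union>(x, s)\<in>Hs \<times> {s\<in>S. T s = b}. F x s)"
        using hist XS by (intro UN_I[of "(\<lambda>i\<in>{..t}. X i \<omega>, X (Suc t) \<omega>)"]) (auto simp: F_def)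
    qed (auto simp: F_def Hs_def)
    then have "\<P>(\<omega> in M. T (X (Suc t) \<omega>) = b \<and> (\<forall>i\<le>t. T (X i \<omega>) = y i))
        = (\<Sum>(x, s)\<in>Hs \<times> {s\<in>S. T s = b}. prob (F x s))"
      using finHs fin mF
      by (simp only:, subst finite_measure_finite_Union[OF _ _ djF]) (auto simp: split_beta)
    also have "\<dots> = (\<Sum>x\<in>Hs. \<Sum>s\<in>{s\<in>S. T s = b}. prob (F x s))"
      by (simp add: sum.cartesian_product)
    also have "\<dots> = (\<Sum>x\<in>Hs. prob (E x) * Q (y t) b)"
    proof (rule sum.cong[OF refl])
      fix x assume x: "x \<in> Hs"
      then have xS: "x i \<in> S" if "i \<le> t" for i using that by (auto simp: Hs_def)
      have "(\<Sum>s\<in>{s\<in>S. T s = b}. prob (F x s)) = (\<Sum>s\<in>{s\<in>S. T s = b}. prob (E x) * P (x t) s)"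
        unfolding F_def E_def by (intro sum.cong refl step) (use xS in auto)
      also have "\<dots> = prob (E x) * fibre_mass S T (P (x t)) b"
        by (simp add: fibre_mass_def sum_distrib_left)
      also have "\<dots> = prob (E x) * Q (y t) b"
        using fib[OF xS[of t] b] x by (simp add: Hs_def)
      finally show "(\<Sum>s\<in>{s\<in>S. T s = b}. prob (F x s)) = prob (E x) * Q (y t) b" .
    qed
    finally show ?thesis unfolding pE by (simp add: sum_distrib_left mult.commute)
  qed
  have meas: "(\<lambda>\<omega>. T (X t \<omega>)) \<in> measurable M (count_space Y)" for t
    by (rule measurable_compose[OF X]) (use T in auto)
  show ?thesis unfolding markov_chain_def
    using prob_space_axioms Q meas by (auto simp: cond_prob_def main)
qed

section \<open>Sylow subgroups of the symmetric group\<close>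

definition shift_perm :: "nat \<Rightarrow> nat \<Rightarrow> (nat \<times> nat \<Rightarrow> 'a) \<Rightarrow> (nat \<Rightarrow> nat) \<Rightarrow> 'a \<Rightarrow> 'a" where
  "shift_perm p k \<phi> e a = (if a \<in> \<phi> ` ({..<k} \<times> {..<p})
     then \<phi> (shift_blocks p e (inv_into ({..<k} \<times> {..<p}) \<phi> a)) else a)"

definition shift_group :: "nat \<Rightarrow> nat \<Rightarrow> (nat \<times> nat \<Rightarrow> 'a) \<Rightarrow> ('a \<Rightarrow> 'a) set" where
  "shift_group p k \<phi> = shift_perm p k \<phi> ` ({..<k} \<rightarrow>\<^sub>E {..<p})"

lemma bij_betw_shift:
  assumes "finite I" "p > 0"
  shows "bij_betw (shift_blocks p e) (I \<times> {..<p}) (I \<times> {..<p})"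
proof -
  have "inj_on (shift_blocks p e) (I \<times> {..<p})"
  proof (rule inj_onI)
    fix x y assume x: "x \<in> I \<times> {..<p}" and y: "y \<in> I \<times> {..<p}" and eq: "shift_blocks p e x = shift_blocks p e y"
    then have "fst x = fst y" by (metis fst_shift)
    moreover from this eq have "[snd x + e (fst x) = snd y + e (fst x)] (mod p)"
      by (simp add: shift_blocks_def rot_def cong_def)
    then have "[snd x = snd y] (mod p)" by (simp add: cong_add_rcancel_nat)
    then have "snd x = snd y" using x y by (auto simp: cong_def)
    ultimately show "x = y" by (simp add: prod_eq_iff)
  qed
  moreover have "shift_blocks p e ` (I \<times> {..<p}) \<subseteq> I \<times> {..<p}" using shift_in[OF assms(2)] by blast
  ultimately show ?thesis using assms by (simp add: bij_betw_def endo_inj_surj)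
qed

locale coordinates =
  fixes p k :: nat and \<phi> :: "nat \<times> nat \<Rightarrow> 'a" and S :: "'a set"
  assumes p: "prime p" and \<phi>: "bij_betw \<phi> ({..<k} \<times> {..<p}) S"
begin

abbreviation "K \<equiv> {..<k} \<times> {..<p}"

lemma p0: "p > 0" using p by (simp add: prime_gt_0_nat)

lemma \<phi>_image: "\<phi> ` K = S" using \<phi> by (simp add: bij_betw_def)

lemma \<phi>_inj: "x \<in> K \<Longrightarrow> y \<in> K \<Longrightarrow> \<phi> x = \<phi> y \<longleftrightarrow> x = y"
  using \<phi> by (auto simp: bij_betw_def inj_on_eq_iff)

lemma inv_\<phi>: "x \<in> K \<Longrightarrow> inv_into K \<phi> (\<phi> x) = x"
  using \<phi> by (rule bij_betw_inv_into_left)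

lemma shift_perm_apply: "x \<in> K \<Longrightarrow> shift_perm p k \<phi> e (\<phi> x) = \<phi> (shift_blocks p e x)"
  by (simp add: shift_perm_def inv_\<phi>)

lemma shift_perm_outside: "a \<notin> S \<Longrightarrow> shift_perm p k \<phi> e a = a"
  by (simp add: shift_perm_def \<phi>_image)

lemma perm_eqI:
  assumes "\<And>a. a \<notin> S \<Longrightarrow> f a = g a" "\<And>x. x \<in> K \<Longrightarrow> f (\<phi> x) = g (\<phi> x)"
  shows "f = g"
proof
  fix a show "f a = g a" using assms \<phi>_image by (cases "a \<in> S") auto
qed

lemma shift_perm_permutes: "shift_perm p k \<phi> e permutes S"
proof (rule bij_imp_permutes)
  have "bij_betw (\<phi> \<circ> shift_blocks p e \<circ> inv_into K \<phi>) S S"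
    using \<phi> bij_betw_shift[OF finite_lessThan p0] bij_betw_inv_into by (metis bij_betw_trans)
  then show "bij_betw (shift_perm p k \<phi> e) S S"
    by (rule bij_betw_cong[THEN iffD1, rotated]) (simp add: shift_perm_def \<phi>_image)
qed (simp add: shift_perm_outside)

lemma shift_perm_inj: "inj_on (shift_perm p k \<phi>) ({..<k} \<rightarrow>\<^sub>E {..<p})"
proof (rule inj_onI)
  fix e g assume e: "e \<in> {..<k} \<rightarrow>\<^sub>E {..<p}" and g: "g \<in> {..<k} \<rightarrow>\<^sub>E {..<p}"
    and eq: "shift_perm p k \<phi> e = shift_perm p k \<phi> g"
  show "e = g"
  proof (rule PiE_ext[OF e g])
    fix i assume i: "i \<in> {..<k}"
    then have x: "(i, 0) \<in> K" using p0 by simp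
    have "\<phi> (shift_blocks p e (i, 0)) = \<phi> (shift_blocks p g (i, 0))"
      using eq shift_perm_apply[OF x] by metis
    then have "shift_blocks p e (i, 0) = shift_blocks p g (i, 0)" using \<phi>_inj shift_in[OF p0 x] by blast
    then have "rot p (e i) (i, 0) = rot p (g i) (i, 0)" by (simp add: shift_blocks_def)
    moreover have "e i < p" "g i < p" using e g i by auto
    ultimately show "e i = g i" using rot_inj by metis
  qed
qed

lemma card_shift_group: "card (shift_group p k \<phi>) = p ^ k"
  by (simp add: shift_group_def card_image[OF shift_perm_inj] card_PiE)

lemma shift_perm_comp:
  "shift_perm p k \<phi> e \<circ> shift_perm p k \<phi> g = shift_perm p k \<phi> (\<lambda>i\<in>{..<k}. (e i + g i) mod p)"
proof (rule perm_eqI)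
  fix x assume x: "x \<in> K"
  have "shift_blocks p e (shift_blocks p g x) = shift_blocks p (\<lambda>i\<in>{..<k}. (e i + g i) mod p) x"
    using x by (auto simp: shift_blocks_def rot_rot intro!: rot_cong)
  then show "(shift_perm p k \<phi> e \<circ> shift_perm p k \<phi> g) (\<phi> x)
      = shift_perm p k \<phi> (\<lambda>i\<in>{..<k}. (e i + g i) mod p) (\<phi> x)"
    using x shift_in[OF p0 x] by (simp add: shift_perm_apply)
qed (simp add: shift_perm_outside)

lemma shift_perm_zero: "shift_perm p k \<phi> (\<lambda>i\<in>{..<k}. 0) = id"
  by (rule perm_eqI) (auto simp: shift_perm_apply shift_perm_outside shift_blocks_def rot_0)

lemma coord_perm_apply:
  assumes "\<sigma> permutes S" "x \<in> K"
  shows "\<phi> (coord_perm K \<phi> \<sigma> x) = \<sigma> (\<phi> x)" "coord_perm K \<phi> \<sigma> x \<in> K"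
proof -
  have "\<phi> x \<in> \<phi> ` K" using assms(2) by blast
  then have "\<sigma> (\<phi> x) \<in> \<phi> ` K" using permutes_in_image[OF assms(1)] by (simp only: \<phi>_image)
  then show "\<phi> (coord_perm K \<phi> \<sigma> x) = \<sigma> (\<phi> x)" "coord_perm K \<phi> \<sigma> x \<in> K"
    using assms(2) inv_into_into[of "\<sigma> (\<phi> x)" \<phi> K] f_inv_into_f[of "\<sigma> (\<phi> x)" \<phi> K]
    by (simp_all only: coord_perm_def restrict_apply' o_apply)
qed

text \<open>The bridge between the group and the blocks: membership of a pair in the stabilizer of
  \<open>\<sigma>\<close> becomes an intertwining relation.\<close>

lemma shift_perm_commute_iff:
  assumes \<sigma>: "\<sigma> permutes S"
  shows "shift_perm p k \<phi> e' \<circ> \<sigma> = \<sigma> \<circ> shift_perm p k \<phi> e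
    \<longleftrightarrow> intertwines p {..<k} (coord_perm K \<phi> \<sigma>) e' e"
proof -
  have on_K: "(shift_perm p k \<phi> e' \<circ> \<sigma>) (\<phi> x) = (\<sigma> \<circ> shift_perm p k \<phi> e) (\<phi> x)
      \<longleftrightarrow> coord_perm K \<phi> \<sigma> (shift_blocks p e x) = shift_blocks p e' (coord_perm K \<phi> \<sigma> x)" if x: "x \<in> K" for x
  proof -
    note c = coord_perm_apply[OF \<sigma>]
    have "(shift_perm p k \<phi> e' \<circ> \<sigma>) (\<phi> x) = \<phi> (shift_blocks p e' (coord_perm K \<phi> \<sigma> x))"
      using c[OF x] shift_perm_apply by (metis comp_apply)
    moreover have "(\<sigma> \<circ> shift_perm p k \<phi> e) (\<phi> x) = \<phi> (coord_perm K \<phi> \<sigma> (shift_blocks p e x))"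
      using c[OF shift_in[OF p0 x]] shift_perm_apply[OF x] by (metis comp_apply)
    ultimately show ?thesis
      using \<phi>_inj[OF c(2)[OF shift_in[OF p0 x]] shift_in[OF p0 c(2)[OF x]]] by metis
  qed
  have out: "(shift_perm p k \<phi> e' \<circ> \<sigma>) a = (\<sigma> \<circ> shift_perm p k \<phi> e) a" if "a \<notin> S" for a
    using that \<sigma> by (simp add: shift_perm_outside permutes_not_in)
  show ?thesis
  proof
    assume "shift_perm p k \<phi> e' \<circ> \<sigma> = \<sigma> \<circ> shift_perm p k \<phi> e"
    then show "intertwines p {..<k} (coord_perm K \<phi> \<sigma>) e' e"
      unfolding intertwines_def using on_K by metis
  next
    assume "intertwines p {..<k} (coord_perm K \<phi> \<sigma>) e' e"
    then show "shift_perm p k \<phi> e' \<circ> \<sigma> = \<sigma> \<circ> shift_perm p k \<phi> e"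
      unfolding intertwines_def using on_K out by (intro perm_eqI) blast+
  qed
qed

text \<open>Conjugation merely relabels the points, so a conjugate of a shift group is again a shift
  group, with coordinates \<open>g \<circ> \<phi>\<close>.\<close>

lemma conj_shift_perm:
  assumes g: "g permutes S"
  shows "g \<circ> shift_perm p k \<phi> e \<circ> inv' g = shift_perm p k (g \<circ> \<phi>) e"
proof -
  have g\<phi>: "bij_betw (g \<circ> \<phi>) K S" using \<phi> permutes_imp_bij[OF g] by (rule bij_betw_trans)
  interpret g: coordinates p k "g \<circ> \<phi>" S using p g\<phi> by unfold_locales
  show ?thesis
  proof (rule g.perm_eqI)
    fix a assume a: "a \<notin> S"
    then have "inv' g a = a" "g a = a"
      using permutes_not_in[OF permutes_inv[OF g]] permutes_not_in[OF g] by auto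
    then show "(g \<circ> shift_perm p k \<phi> e \<circ> inv' g) a = shift_perm p k (g \<circ> \<phi>) e a"
      using a by (simp add: shift_perm_outside g.shift_perm_outside)
  next
    fix x assume x: "x \<in> K"
    have "(g \<circ> shift_perm p k \<phi> e \<circ> inv' g) ((g \<circ> \<phi>) x) = g (shift_perm p k \<phi> e (\<phi> x))"
      using g by (simp add: permutes_inverses)
    then show "(g \<circ> shift_perm p k \<phi> e \<circ> inv' g) ((g \<circ> \<phi>) x)
        = shift_perm p k (g \<circ> \<phi>) e ((g \<circ> \<phi>) x)"
      unfolding g.shift_perm_apply[OF x] shift_perm_apply[OF x] by simp
  qed
qed

end

section \<open>The Sylow subgroups of the symmetric group in coordinates\<close>

lemma order_sym_group: "order (sym_group n) = fact n"
  using card_permutations[of "{1..n}" n] by (simp add: order_def sym_group_def)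

lemma finite_sym_group: "finite (carrier (sym_group n))"
  by (simp add: sym_group_def finite_permutations)

text \<open>No factor of the factorial is divisible by \<open>p ^ 2\<close>, so the multiplicity
  just counts the multiples of \<open>p\<close> up to \<open>n\<close>.\<close>

lemma multiplicity_fact_lt_square:
  assumes p: "prime (p::nat)" and n: "n < p * p"
  shows "multiplicity p (fact n :: nat) = n div p"
  using n
proof (induction n)
  case 0
  then show ?case by simp
next
  case (Suc n)
  have pp: "p > 1" using p by (rule prime_gt_1_nat)
  have "multiplicity p (fact (Suc n) :: nat) = multiplicity p (Suc n) + multiplicity p (fact n :: nat)"
    using p unfolding fact_Suc of_nat_id
    by (intro prime_elem_multiplicity_mult_distrib) auto
  also have "multiplicity p (Suc n) = (if p dvd Suc n then 1 else 0)"
  proof (cases "p dvd Suc n")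
    case True
    have "\<not> p ^ Suc 1 dvd Suc n" using Suc.prems by (auto simp: dest!: dvd_imp_le)
    then show ?thesis using True by (intro multiplicity_eqI[THEN trans]) auto
  qed (simp add: not_dvd_imp_multiplicity_0)
  also have "multiplicity p (fact n :: nat) = n div p" using Suc by simp
  finally show ?case by (simp add: div_Suc dvd_eq_mod_eq_0)
qed

lemma multiplicity_order_sym_group:
  assumes "prime (p::nat)" "k < p"
  shows "multiplicity p (order (sym_group (p * k))) = k"
  using assms by (simp add: order_sym_group multiplicity_fact_lt_square prime_gt_0_nat)

text \<open>Division with remainder by \<open>p\<close>, moved by 1 because \<open>sym_group\<close>
  acts on \<open>{1..n}\<close>.\<close>

lemma standard_coordinates:
  assumes "(p::nat) > 0"
  shows "bij_betw (\<lambda>(i, r). p * i + r + 1) ({..<k} \<times> {..<p}) {1..p * k}"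
proof (rule bij_betw_byWitness[where f' = "\<lambda>a. ((a - 1) div p, (a - 1) mod p)"])
  show "(\<lambda>(i, r). p * i + r + 1) ` ({..<k} \<times> {..<p}) \<subseteq> {1..p * k}"
  proof clarify
    fix i r assume "i < k" "r < p"
    then have "p * i + r + 1 \<le> p * Suc i" by simp
    also have "\<dots> \<le> p * k" using \<open>i < k\<close> by (intro mult_le_mono2) simp
    finally show "p * i + r + 1 \<in> {1..p * k}" by simp
  qed
  show "(\<lambda>a. ((a - 1) div p, (a - 1) mod p)) ` {1..p * k} \<subseteq> {..<k} \<times> {..<p}"
    using assms by (auto simp: div_less_iff_less_mult mult.commute)
qed (use assms in auto)

lemma subgroup_shift_group:
  assumes p: "prime p" and \<phi>: "bij_betw \<phi> ({..<k} \<times> {..<p}) {1..p * k}"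
  shows "subgroup (shift_group p k \<phi>) (sym_group (p * k))"
proof -
  interpret coordinates p k \<phi> "{1..p * k}" using p \<phi> by unfold_locales
  interpret group "sym_group (p * k)" by (rule sym_group_is_group)
  have mem: "shift_perm p k \<phi> (restrict e {..<k}) \<in> shift_group p k \<phi>"
    if "\<And>i. e i < p" for e
    using that by (auto simp: shift_group_def)
  show ?thesis
  proof (rule subgroupI)
    show "shift_group p k \<phi> \<subseteq> carrier (sym_group (p * k))"
      using shift_perm_permutes by (auto simp: shift_group_def sym_group_carrier)
    show "shift_group p k \<phi> \<noteq> {}" using mem[of "\<lambda>_. 0"] p0 by auto
    fix a assume "a \<in> shift_group p k \<phi>"
    then obtain e where e: "a = shift_perm p k \<phi> e" "e \<in> {..<k} \<rightarrow>\<^sub>E {..<p}"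
      by (auto simp: shift_group_def)
    \<comment> \<open>The exponents of the inverse. The \<open>mod p\<close> brings the value
      \<open>p\<close>, which arises from \<open>e i = 0\<close>, back to 0.\<close>
    define e' where "e' = (\<lambda>i\<in>{..<k}. (p - e i) mod p)"
    have "(\<lambda>i\<in>{..<k}. (e' i + e i) mod p) = (\<lambda>i\<in>{..<k}. 0)"
    proof (rule restrict_ext)
      fix i assume "i \<in> {..<k}"
      then have "e i < p" using e by auto
      then show "(e' i + e i) mod p = 0" using \<open>i \<in> {..<k}\<close> by (simp add: e'_def mod_simps)
    qed
    then have "shift_perm p k \<phi> e' \<circ> a = id" using shift_perm_comp[of e' e] shift_perm_zero e(1) by metis
    moreover have m: "shift_perm p k \<phi> e' \<in> shift_group p k \<phi>" unfolding e'_def using p0 by (intro mem) simp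
    ultimately have "inv\<^bsub>sym_group (p * k)\<^esub> a = shift_perm p k \<phi> e'"
      using shift_perm_permutes e(1)
      by (intro inv_equality) (simp_all add: sym_group_mult sym_group_one sym_group_carrier)
    then show "inv\<^bsub>sym_group (p * k)\<^esub> a \<in> shift_group p k \<phi>" using m by metis
  next
    fix a b assume "a \<in> shift_group p k \<phi>" "b \<in> shift_group p k \<phi>"
    then show "a \<otimes>\<^bsub>sym_group (p * k)\<^esub> b \<in> shift_group p k \<phi>"
      using p0 by (auto simp: shift_group_def sym_group_mult shift_perm_comp intro!: imageI)
  qed
qed

lemma sylow_shift_group:
  assumes "prime p" "k < p" "bij_betw \<phi> ({..<k} \<times> {..<p}) {1..p * k}"
  shows "sylow_subgroup p (shift_group p k \<phi>) (sym_group (p * k))"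
  using subgroup_shift_group[OF assms(1,3)] coordinates.card_shift_group[OF coordinates.intro[OF assms(1,3)]]
  by (simp add: sylow_subgroup_def multiplicity_order_sym_group assms(1,2))

lemma sylow_coordinates:
  assumes p: "prime p" and k: "k < p" and H: "sylow_subgroup p H (sym_group (p * k))"
  obtains \<phi> where "bij_betw \<phi> ({..<k} \<times> {..<p}) {1..p * k}" "H = shift_group p k \<phi>"
proof -
  interpret group "sym_group (p * k)" by (rule sym_group_is_group)
  define \<phi>0 :: "nat \<times> nat \<Rightarrow> nat" where "\<phi>0 = (\<lambda>(i, r). p * i + r + 1)"
  have \<phi>0: "bij_betw \<phi>0 ({..<k} \<times> {..<p}) {1..p * k}"
    unfolding \<phi>0_def using p by (intro standard_coordinates) (simp add: prime_gt_0_nat)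
  interpret coordinates p k \<phi>0 "{1..p * k}" using p \<phi>0 by unfold_locales
  have mult: "multiplicity p (order (sym_group (p * k))) = k" by (rule multiplicity_order_sym_group[OF p k])
  have "\<not> p ^ Suc k dvd order (sym_group (p * k))"
  proof -
    have "order (sym_group (p * k)) \<noteq> 0" by (simp add: order_sym_group)
    then show ?thesis using p mult power_dvd_iff_le_multiplicity
      by (metis Suc_n_not_le_n not_prime_unit)
  qed
  moreover have "card H = p ^ k" "subgroup H (sym_group (p * k))" using H mult by (auto simp: sylow_subgroup_def)
  ultimately obtain g where g: "g \<in> carrier (sym_group (p * k))"
    "H = (\<lambda>h. g \<otimes>\<^bsub>sym_group (p * k)\<^esub> h \<otimes>\<^bsub>sym_group (p * k)\<^esub> inv\<^bsub>sym_group (p * k)\<^esub> g) ` shift_group p k \<phi>0"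
    using sylow_conjugate[OF finite_sym_group p _ subgroup_shift_group[OF p \<phi>0] _ card_shift_group] by metis
  have gp: "g permutes {1..p * k}" using g by (simp add: sym_group_carrier)
  have "inv\<^bsub>sym_group (p * k)\<^esub> g = inv' g"
    using gp permutes_inv[OF gp] g(1)
    by (intro inv_equality) (simp_all add: sym_group_mult sym_group_one sym_group_carrier permutes_inv_o)
  then have "H = shift_group p k (g \<circ> \<phi>0)"
    unfolding g(2) shift_group_def image_image sym_group_mult by (simp only: conj_shift_perm[OF gp])
  moreover have "bij_betw (g \<circ> \<phi>0) ({..<k} \<times> {..<p}) {1..p * k}"
    using \<phi>0 permutes_imp_bij[OF gp] by (rule bij_betw_trans)
  ultimately show ?thesis using that by blast
qed

section \<open>The lumped Sylow--Burnside kernel\<close>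

locale sylow_blocks = coordinates p k \<phi> "{1..p * k}"
  for p k :: nat and \<phi> :: "nat \<times> nat \<Rightarrow> nat" +
  assumes k_less: "k < p"
begin

abbreviation "G \<equiv> sym_group (p * k)"
abbreviation "H \<equiv> shift_group p k \<phi>"

definition match_number :: "(nat \<Rightarrow> nat) \<Rightarrow> nat" where
  "match_number \<sigma> = card (matched p {..<k} (coord_perm K \<phi> \<sigma>))"

sublocale G: group G by (rule sym_group_is_group)

lemma subgroup_H: "subgroup H G" by (rule subgroup_shift_group[OF p \<phi>])

lemma finite_H: "finite H" by (simp add: shift_group_def finite_PiE)

lemma p_gt_1: "p > 1" using p by (rule prime_gt_1_nat)

lemma coord_perm_block: "\<sigma> \<in> carrier G \<Longrightarrow> coord_perm K \<phi> \<sigma> \<in> block_bijections p k"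
  using bij_betwE[OF bij_betw_coord_perm[OF \<phi>]] by (auto simp: block_bijections_def sym_group_carrier)

lemma block_bijection_coord_perm:
  "\<sigma> \<in> carrier G \<Longrightarrow> block_bijection p {..<k} {..<k} (coord_perm K \<phi> \<sigma>)"
  using coord_perm_block p by (simp add: block_bijection_def block_bijections_def)

lemma match_number_le: "match_number \<sigma> \<le> k"
proof -
  have "card (matched p {..<k} (coord_perm K \<phi> \<sigma>)) \<le> card {..<k}"
    by (intro card_mono) (auto simp: matched_def)
  then show ?thesis by (simp add: match_number_def)
qed

lemma mem_twisted_stab:
  assumes "\<sigma> \<in> carrier G" "e' \<in> {..<k} \<rightarrow>\<^sub>E {..<p}" "e \<in> {..<k} \<rightarrow>\<^sub>E {..<p}"
  shows "(shift_perm p k \<phi> e', shift_perm p k \<phi> e) \<in> twisted_stab G H H \<sigma>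
    \<longleftrightarrow> intertwines p {..<k} (coord_perm K \<phi> \<sigma>) e' e"
  using assms shift_perm_commute_iff[of \<sigma> e' e]
  by (simp add: twisted_stab_def sym_group_mult sym_group_carrier shift_group_def)

lemma bij_betw_twisted_stab:
  assumes \<sigma>: "\<sigma> \<in> carrier G"
  shows "bij_betw (map_prod (shift_perm p k \<phi>) (shift_perm p k \<phi>))
    (stab_pairs p {..<k} {..<k} (coord_perm K \<phi> \<sigma>)) (twisted_stab G H H \<sigma>)"
proof -
  let ?E = "{..<k} \<rightarrow>\<^sub>E {..<p}"
  have "bij_betw (shift_perm p k \<phi>) ?E H"
    using shift_perm_inj by (simp add: bij_betw_def shift_group_def)
  then have "bij_betw (map_prod (shift_perm p k \<phi>) (shift_perm p k \<phi>)) (?E \<times> ?E) (H \<times> H)"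
    by (intro bij_betw_map_prod)
  then have "bij_betw (map_prod (shift_perm p k \<phi>) (shift_perm p k \<phi>))
    {z \<in> ?E \<times> ?E. intertwines p {..<k} (coord_perm K \<phi> \<sigma>) (fst z) (snd z)}
    {w \<in> H \<times> H. w \<in> twisted_stab G H H \<sigma>}"
    by (rule bij_betw_Collect) (use mem_twisted_stab[OF \<sigma>] in auto)
  moreover have "{w \<in> H \<times> H. w \<in> twisted_stab G H H \<sigma>} = twisted_stab G H H \<sigma>"
    by (auto simp: twisted_stab_def)
  moreover have "{z \<in> ?E \<times> ?E. intertwines p {..<k} (coord_perm K \<phi> \<sigma>) (fst z) (snd z)}
      = stab_pairs p {..<k} {..<k} (coord_perm K \<phi> \<sigma>)"
    unfolding stab_pairs_def by (rule Collect_cong) (simp only: split_beta prod.collapse)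
  ultimately show ?thesis by (simp only:)
qed

lemma card_twisted_stab:
  assumes \<sigma>: "\<sigma> \<in> carrier G"
  shows "card (twisted_stab G H H \<sigma>) = p ^ match_number \<sigma>"
  using bij_betw_same_card[OF bij_betw_twisted_stab[OF \<sigma>]]
    block_bijection.card_stab_pairs[OF block_bijection_coord_perm[OF \<sigma>]]
  by (simp add: match_number_def)

text \<open>Orbit-stabilizer for \<open>H \<times> H\<close>, which has \<open>p ^ (2 * k)\<close>
  elements. The match number is at most \<open>k\<close>, so the natural subtraction in the exponent
  is a genuine one.\<close>

lemma card_double_coset:
  assumes \<sigma>: "\<sigma> \<in> carrier G"
  shows "card (double_coset G H \<sigma>) = p ^ (2 * k - match_number \<sigma>)"
proof -
  have "card (double_coset G H \<sigma>) * p ^ match_number \<sigma> = p ^ k * p ^ k"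
    using G.card_mixed_double_coset[OF subgroup_H subgroup_H \<sigma> finite_H finite_H]
      G.double_coset_eq[OF subgroup_H \<sigma>] card_twisted_stab[OF \<sigma>] card_shift_group by simp
  also have "\<dots> = p ^ (2 * k - match_number \<sigma>) * p ^ match_number \<sigma>"
    using match_number_le[of \<sigma>] by (simp flip: power_add add: mult_2)
  finally show ?thesis using p0 by simp
qed

lemma card_double_coset_eq_iff:
  "\<sigma> \<in> carrier G \<Longrightarrow> card (double_coset G H \<sigma>) = p ^ a \<longleftrightarrow> 2 * k - match_number \<sigma> = a"
  using p_gt_1 by (simp add: card_double_coset)

lemma double_coset_exponent_eq:
  "\<sigma> \<in> carrier G \<Longrightarrow> double_coset_exponent p G H \<sigma> = 2 * k - match_number \<sigma>"
  by (simp add: double_coset_exponent_def card_double_coset_eq_iff)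

lemma card_double_coset_exponent:
  "card {\<sigma> \<in> carrier G. 2 * k - match_number \<sigma> = a}
    = card {\<sigma> \<in> block_bijections p k. 2 * k - card (matched p {..<k} \<sigma>) = a}"
proof -
  have "bij_betw (coord_perm K \<phi>) (carrier G) (block_bijections p k)"
    using bij_betw_coord_perm[OF \<phi>] by (simp add: block_bijections_def sym_group_def)
  then have "bij_betw (coord_perm K \<phi>) {\<sigma> \<in> carrier G. 2 * k - match_number \<sigma> = a}
      {\<sigma> \<in> block_bijections p k. 2 * k - card (matched p {..<k} \<sigma>) = a}"
    by (rule bij_betw_Collect) (simp add: match_number_def)
  then show ?thesis by (rule bij_betw_same_card)
qed

text \<open>Both sides count the permutations of exponent \<open>a\<close>: on the left they are
  grouped into double cosets of \<open>p ^ a\<close> elements each, on the right they are read in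
  coordinates.\<close>

lemma card_double_cosets_exponent:
  "p ^ a * card {D \<in> double_cosets G H. card D = p ^ a}
    = card {\<sigma> \<in> block_bijections p k. 2 * k - card (matched p {..<k} \<sigma>) = a}"
proof -
  have fin: "finite (double_cosets G H)" by (simp add: double_cosets_def finite_sym_group)
  have "(\<Sum>\<sigma>\<in>carrier G. if card (double_coset G H \<sigma>) = p ^ a then 1 else 0)
      = (\<Sum>D\<in>double_cosets G H. of_nat (card D) * (if card D = p ^ a then 1 else 0 :: nat))"
    by (rule G.sum_over_double_cosets[OF finite_sym_group subgroup_H])
  also have "\<dots> = (\<Sum>D\<in>double_cosets G H. if card D = p ^ a then p ^ a else 0)"
    by (intro sum.cong) auto
  also have "\<dots> = p ^ a * card {D \<in> double_cosets G H. card D = p ^ a}"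
    using fin by (simp add: sum.If_cases Int_def mult.commute)
  also have "(\<Sum>\<sigma>\<in>carrier G. if card (double_coset G H \<sigma>) = p ^ a then 1 else 0 :: nat)
      = card {\<sigma> \<in> carrier G. 2 * k - match_number \<sigma> = a}"
    using finite_sym_group by (simp add: sum.If_cases Int_def card_double_coset_eq_iff cong: conj_cong)
  finally show ?thesis by (simp add: card_double_coset_exponent)
qed

end

text \<open>The right-hand side mentions no Sylow subgroup, so the count does not depend on the one
  picked by \<open>SOME\<close>. The case \<open>k = 0\<close> is included; it occurs when all
  blocks are moved.\<close>

lemma sylow_double_coset_count:
  assumes p: "prime p" and k: "k < p"
  shows "p ^ a * sylow_double_coset_count p a k
    = card {\<sigma> \<in> block_bijections p k. 2 * k - card (matched p {..<k} \<sigma>) = a}"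
proof -
  define H where "H = (SOME H. sylow_subgroup p H (sym_group (p * k)))"
  have "sylow_subgroup p H (sym_group (p * k))"
    unfolding H_def
    by (rule someI) (rule sylow_shift_group[OF p k standard_coordinates], use p prime_gt_0_nat in blast)
  then obtain \<phi> where coord: "bij_betw \<phi> ({..<k} \<times> {..<p}) {1..p * k}" "H = shift_group p k \<phi>"
    using sylow_coordinates[OF p k] by metis
  interpret sylow_blocks p k \<phi> using p coord(1) k by unfold_locales
  show ?thesis using card_double_cosets_exponent[of a] coord(2)
    by (simp add: sylow_double_coset_count_def Let_def flip: H_def)
qed

text \<open>The probability that a uniformly random bijection of \<open>k - y\<close> blocks,
  completed by \<open>y\<close> further matched blocks, has exponent \<open>b\<close>.\<close>

definition block_ratio :: "nat \<Rightarrow> nat \<Rightarrow> nat \<Rightarrow> nat \<Rightarrow> real" where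
  "block_ratio p k b y =
     real (card {\<rho> \<in> block_bijections p (k - y). 2 * k - (y + card (matched p {..<k - y} \<rho>)) = b})
       / fact (p * (k - y))"

text \<open>With \<open>m\<close> matched blocks among the remaining ones,
  \<open>2 * k - (y + m) = b\<close> is the same as \<open>2 * (k - y) - m = b - y\<close>. If
  \<open>y\<close> exceeds \<open>2 * k - b\<close>, the \<open>y\<close> matched blocks alone push
  the exponent below \<open>b\<close>; the case distinction keeps truncated subtraction from hiding
  this.\<close>

lemma block_ratio_eq:
  assumes p: "prime p" and k: "k < p" and b: "k \<le> b" and y: "y \<le> k"
  shows "block_ratio p k b y = (if y \<le> 2 * k - b \<and> b \<le> 2 * k
    then real p ^ (b - y) * real (sylow_double_coset_count p (b - y) (k - y)) / fact (p * (k - y)) else 0)"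
proof -
  have le: "card (matched p {..<k - y} \<rho>) \<le> k - y" for \<rho> :: "nat \<times> nat \<Rightarrow> nat \<times> nat"
    using card_mono[of "{..<k - y}" "matched p {..<k - y} \<rho>"] by (auto simp: matched_def)
  have "{\<rho> \<in> block_bijections p (k - y). 2 * k - (y + card (matched p {..<k - y} \<rho>)) = b}
    = (if y \<le> 2 * k - b \<and> b \<le> 2 * k then {\<rho> \<in> block_bijections p (k - y). 2 * (k - y) - card (matched p {..<k - y} \<rho>) = b - y} else {})"
  proof -
    have "2 * k - (y + card (matched p {..<k - y} \<rho>)) = b \<longleftrightarrow> y \<le> 2 * k - b \<and> b \<le> 2 * k \<and>
        2 * (k - y) - card (matched p {..<k - y} \<rho>) = b - y" for \<rho> :: "nat \<times> nat \<Rightarrow> nat \<times> nat"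
      using le[of \<rho>] b y by linarith
    then show ?thesis by auto
  qed
  then show ?thesis
    using sylow_double_coset_count[OF p, of "k - y" "b - y"] k
    by (simp add: block_ratio_def flip: of_nat_power of_nat_mult)
qed

text \<open>At most \<open>k - y\<close> of the remaining blocks are matched, so every bijection has
  its exponent in \<open>{k..2 * k}\<close> and is counted exactly once.\<close>

lemma sum_block_ratio:
  assumes y: "y \<le> k"
  shows "(\<Sum>b\<in>{k..2 * k}. block_ratio p k b y) = 1"
proof -
  have le: "card (matched p {..<k - y} \<rho>) \<le> k - y" for \<rho> :: "nat \<times> nat \<Rightarrow> nat \<times> nat"
    using card_mono[of "{..<k - y}" "matched p {..<k - y} \<rho>"] by (auto simp: matched_def)
  have fin: "finite (block_bijections p (k - y))" by (simp add: block_bijections_def finite_bijections)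
  have "(\<Sum>b\<in>{k..2 * k}. card {\<rho> \<in> block_bijections p (k - y). 2 * k - (y + card (matched p {..<k - y} \<rho>)) = b})
      = (\<Sum>b\<in>{k..2 * k}. \<Sum>\<rho>\<in>{\<rho> \<in> block_bijections p (k - y). 2 * k - (y + card (matched p {..<k - y} \<rho>)) = b}. 1)"
    by simp
  also have "\<dots> = (\<Sum>\<rho>\<in>block_bijections p (k - y). 1)"
  proof (rule sum.group[OF fin])
    show "(\<lambda>\<rho>. 2 * k - (y + card (matched p {..<k - y} \<rho>))) ` block_bijections p (k - y) \<subseteq> {k..2 * k}"
    proof clarify
      fix \<rho> :: "nat \<times> nat \<Rightarrow> nat \<times> nat"
      show "2 * k - (y + card (matched p {..<k - y} \<rho>)) \<in> {k..2 * k}" using le[of \<rho>] y by auto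
    qed
  qed simp
  also have "\<dots> = fact (p * (k - y))" by (simp add: card_block_bijections)
  finally have "real (\<Sum>b\<in>{k..2 * k}. card {\<rho> \<in> block_bijections p (k - y). 2 * k - (y + card (matched p {..<k - y} \<rho>)) = b})
      = fact (p * (k - y))" by simp
  then show ?thesis unfolding block_ratio_def by (simp flip: sum_divide_distrib)
qed

definition lumped_kernel :: "nat \<Rightarrow> nat \<Rightarrow> nat \<Rightarrow> nat \<Rightarrow> real" where
  "lumped_kernel p k a b = (\<Sum>y = 0..2 * k - max a b.
     real ((2 * k - a) choose y) * ((real p - 1) / real p) ^ y
     * (real p ^ (a + b - 2 * k) / fact (p * (k - y)))
     * real (sylow_double_coset_count p (b - y) (k - y)))"

text \<open>The right-hand side is the average over the \<open>p ^ (2 * k - a)\<close> stabilizer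
  pairs. Since \<open>p ^ (b - y) / p ^ (2 * k - a) = p ^ (a + b - 2 * k) / p ^ y\<close>, the
  denominator \<open>p ^ y\<close> turns \<open>(p - 1) ^ y\<close> into
  \<open>((p - 1) / p) ^ y\<close>. The upper limit with \<open>max a b\<close> arises because the
  binomial vanishes beyond \<open>2 * k - a\<close> and \<open>block_ratio\<close> beyond
  \<open>2 * k - b\<close>.\<close>

lemma lumped_kernel_eq:
  assumes p: "prime p" and k: "k < p" and a: "a \<in> {k..2 * k}" and b: "b \<in> {k..2 * k}"
  shows "lumped_kernel p k a b = 1 / real p ^ (2 * k - a) *
    (\<Sum>y\<le>k. real ((2 * k - a) choose y) * (real p - 1) ^ y * block_ratio p k b y)"
proof -
  have p0: "real p > 0" using p by (simp add: prime_gt_0_nat)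
  have "(\<Sum>y\<le>k. real ((2 * k - a) choose y) * (real p - 1) ^ y * block_ratio p k b y)
      = (\<Sum>y = 0..2 * k - max a b. real ((2 * k - a) choose y) * (real p - 1) ^ y * block_ratio p k b y)"
  proof (rule sum.mono_neutral_right)
    show "{0..2 * k - max a b} \<subseteq> {..k}" using a b by auto
    show "\<forall>y\<in>{..k} - {0..2 * k - max a b}.
        real ((2 * k - a) choose y) * (real p - 1) ^ y * block_ratio p k b y = 0"
    proof
      fix y assume y: "y \<in> {..k} - {0..2 * k - max a b}"
      then have "2 * k - a < y \<or> \<not> y \<le> 2 * k - b" using a b by auto
      then show "real ((2 * k - a) choose y) * (real p - 1) ^ y * block_ratio p k b y = 0"
        using block_ratio_eq[OF p k, of b y] b y by (auto simp: binomial_eq_0)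
    qed
  qed simp
  moreover have term_eq: "1 / real p ^ (2 * k - a) *
      (real ((2 * k - a) choose y) * (real p - 1) ^ y * block_ratio p k b y)
      = real ((2 * k - a) choose y) * ((real p - 1) / real p) ^ y
        * (real p ^ (a + b - 2 * k) / fact (p * (k - y)))
        * real (sylow_double_coset_count p (b - y) (k - y))"
    if y: "y \<in> {0..2 * k - max a b}" for y
  proof -
    have yk: "y \<le> k" "y \<le> 2 * k - b" "y \<le> b" using y a b by auto
    have "real p ^ (b - y) * real p ^ y = real p ^ (a + b - 2 * k) * real p ^ (2 * k - a)"
      using yk a b by (simp flip: power_add)
    then have *: "real p ^ (b - y) / real p ^ (2 * k - a) = real p ^ (a + b - 2 * k) / real p ^ y"
      using p0 by (simp add: field_simps)
    have br: "block_ratio p k b y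
        = real p ^ (b - y) * real (sylow_double_coset_count p (b - y) (k - y)) / fact (p * (k - y))"
      using block_ratio_eq[OF p k, of b y] yk b by simp
    have "1 / real p ^ (2 * k - a) *
      (real ((2 * k - a) choose y) * (real p - 1) ^ y * block_ratio p k b y)
      = real ((2 * k - a) choose y) * (real p - 1) ^ y * (real p ^ (b - y) / real p ^ (2 * k - a))
        / fact (p * (k - y)) * real (sylow_double_coset_count p (b - y) (k - y))"
      by (simp add: br)
    also have "\<dots> = real ((2 * k - a) choose y) * ((real p - 1) / real p) ^ y
        * (real p ^ (a + b - 2 * k) / fact (p * (k - y)))
        * real (sylow_double_coset_count p (b - y) (k - y))"
      unfolding * by (simp add: power_divide)
    finally show ?thesis .
  qed
  ultimately show ?thesis
    unfolding lumped_kernel_def by (simp only: sum_distrib_left term_eq cong: sum.cong)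
qed

text \<open>The row sums cannot be read off from those of the Burnside kernel, because a row \<open>a\<close> may belong to
  an exponent that no double coset has (for instance \<open>a = 2\<close> when \<open>p = 2\<close> and \<open>k = 1\<close>).\<close>

lemma transition_kernel_lumped_kernel:
  assumes p: "prime p" and k: "k < p"
  shows "transition_kernel {k..2 * k} (lumped_kernel p k)"
  unfolding transition_kernel_def
proof (intro ballI conjI)
  have p1: "real p \<ge> 1" using prime_ge_1_nat[OF p] by simp
  fix a assume a: "a \<in> {k..2 * k}"
  show "0 \<le> lumped_kernel p k a b" if "b \<in> {k..2 * k}" for b
    using p1 unfolding lumped_kernel_def by (intro sum_nonneg mult_nonneg_nonneg zero_le_power divide_nonneg_nonneg) auto
  have "(\<Sum>b\<in>{k..2 * k}. lumped_kernel p k a b) = 1 / real p ^ (2 * k - a) *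
    (\<Sum>y\<le>k. real ((2 * k - a) choose y) * (real p - 1) ^ y * (\<Sum>b\<in>{k..2 * k}. block_ratio p k b y))"
  proof -
    have "(\<Sum>b\<in>{k..2 * k}. lumped_kernel p k a b) = 1 / real p ^ (2 * k - a) * (\<Sum>b\<in>{k..2 * k}.
        \<Sum>y\<le>k. real ((2 * k - a) choose y) * (real p - 1) ^ y * block_ratio p k b y)"
      unfolding sum_distrib_left[of "1 / real p ^ (2 * k - a)" _ "{k..2 * k}"]
      using lumped_kernel_eq[OF p k a] by (intro sum.cong refl) blast
    then show ?thesis by (simp only: sum_distrib_left sum.swap[of _ "{k..2 * k}" "{..k}"])
  qed
  also have "(\<Sum>y\<le>k. real ((2 * k - a) choose y) * (real p - 1) ^ y * (\<Sum>b\<in>{k..2 * k}. block_ratio p k b y))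
      = (\<Sum>y\<le>k. real ((2 * k - a) choose y) * (real p - 1) ^ y)"
    by (intro sum.cong) (auto simp: sum_block_ratio)
  also have "\<dots> = (\<Sum>y\<le>2 * k - a. real ((2 * k - a) choose y) * (real p - 1) ^ y)"
    using a by (intro sum.mono_neutral_right) (auto simp: binomial_eq_0)
  \<comment> \<open>The binomial theorem; the result \<open>p ^ (2 * k - a)\<close> cancels against
    the prefactor.\<close>
  also have "\<dots> = (real p - 1 + 1) ^ (2 * k - a)" by (subst binomial_ring) simp
  finally show "(\<Sum>b\<in>{k..2 * k}. lumped_kernel p k a b) = 1" using p1 by simp
qed

context sylow_blocks
begin

text \<open>The average over stabilizer pairs from \<open>sum_burnside_kernel\<close> is carried to
  exponent vectors and evaluated by \<open>sum_fixed_ratio\<close>. The result involves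
  \<open>\<sigma>\<close> only through its match number, that is, through its exponent.\<close>

lemma fibre_mass_burnside_kernel:
  assumes \<sigma>: "\<sigma> \<in> carrier G" and b: "b \<in> {k..2 * k}"
  shows "fibre_mass (carrier G) (double_coset_exponent p G H) (burnside_kernel G H \<sigma>) b
    = lumped_kernel p k (double_coset_exponent p G H \<sigma>) b"
proof -
  let ?K = "{..<k} \<times> {..<p}" and ?\<kappa> = "coord_perm ({..<k} \<times> {..<p}) \<phi>" and ?s = "shift_perm p k \<phi>"
  define B where "B = {\<tau> \<in> carrier G. 2 * k - match_number \<tau> = b}"
  interpret \<kappa>: block_bijection p "{..<k}" "{..<k}" "?\<kappa> \<sigma>"
    by (rule block_bijection_coord_perm[OF \<sigma>])
  have B: "{\<tau> \<in> carrier G. double_coset_exponent p G H \<tau> = b} = B"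
    unfolding B_def using double_coset_exponent_eq by auto
  have exp: "2 * k - double_coset_exponent p G H \<sigma> = match_number \<sigma>"
    "double_coset_exponent p G H \<sigma> \<in> {k..2 * k}"
    using double_coset_exponent_eq[OF \<sigma>] match_number_le[of \<sigma>] by auto
  \<comment> \<open>Kept general in \<open>Pr\<close> so that it yields the numerator, with exponent
    \<open>b\<close>, as well as the denominator, with the always true predicate.\<close>
  have cards: "card {\<tau> \<in> carrier G. Pr (match_number \<tau>) \<and> (?s e', ?s e) \<in> twisted_stab G H H \<tau>}
      = card {\<tau> \<in> bijections ?K ?K. intertwines p {..<k} \<tau> e' e \<and> Pr (card (matched p {..<k} \<tau>))}"
    if "(e', e) \<in> stab_pairs p {..<k} {..<k} (?\<kappa> \<sigma>)" for e' e Pr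
  proof -
    have e: "e' \<in> {..<k} \<rightarrow>\<^sub>E {..<p}" "e \<in> {..<k} \<rightarrow>\<^sub>E {..<p}" using that by (auto simp: stab_pairs_def)
    have "bij_betw ?\<kappa> (carrier G) (bijections ?K ?K)"
      using bij_betw_coord_perm[OF \<phi>] by (simp add: sym_group_def)
    then have "bij_betw ?\<kappa> {\<tau> \<in> carrier G. Pr (match_number \<tau>) \<and> (?s e', ?s e) \<in> twisted_stab G H H \<tau>}
      {\<tau> \<in> bijections ?K ?K. intertwines p {..<k} \<tau> e' e \<and> Pr (card (matched p {..<k} \<tau>))}"
      by (rule bij_betw_Collect) (use mem_twisted_stab[OF _ e] in \<open>auto simp: match_number_def\<close>)
    then show ?thesis by (rule bij_betw_same_card)
  qed
  have "fibre_mass (carrier G) (double_coset_exponent p G H) (burnside_kernel G H \<sigma>) b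
      = (\<Sum>\<tau>\<in>B. burnside_kernel G H \<sigma> \<tau>)"
    unfolding fibre_mass_def B ..
  also have "\<dots> = 1 / real (card (twisted_stab G H H \<sigma>)) *
    (\<Sum>hg\<in>twisted_stab G H H \<sigma>. real (card {\<tau> \<in> B. hg \<in> twisted_stab G H H \<tau>})
       / real (card {\<tau> \<in> carrier G. hg \<in> twisted_stab G H H \<tau>}))"
    by (rule G.sum_burnside_kernel[OF finite_sym_group subgroup_H \<sigma>]) (auto simp: B_def)
  also have "(\<Sum>hg\<in>twisted_stab G H H \<sigma>. real (card {\<tau> \<in> B. hg \<in> twisted_stab G H H \<tau>})
       / real (card {\<tau> \<in> carrier G. hg \<in> twisted_stab G H H \<tau>}))
     = (\<Sum>z\<in>stab_pairs p {..<k} {..<k} (?\<kappa> \<sigma>).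
         real (card {\<tau> \<in> B. map_prod ?s ?s z \<in> twisted_stab G H H \<tau>})
       / real (card {\<tau> \<in> carrier G. map_prod ?s ?s z \<in> twisted_stab G H H \<tau>}))"
    by (rule sum.reindex_bij_betw[OF bij_betw_twisted_stab[OF \<sigma>], symmetric])
  also have "\<dots> = (\<Sum>(e', e)\<in>stab_pairs p {..<k} {..<k} (?\<kappa> \<sigma>).
      real (card {\<tau> \<in> bijections ?K ?K. intertwines p {..<k} \<tau> e' e \<and> 2 * k - card (matched p {..<k} \<tau>) = b})
      / real (card {\<tau> \<in> bijections ?K ?K. intertwines p {..<k} \<tau> e' e}))"
  proof (rule sum.cong[OF refl], clarify)
    fix e' e assume z: "(e', e) \<in> stab_pairs p {..<k} {..<k} (?\<kappa> \<sigma>)"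
    show "real (card {\<tau> \<in> B. map_prod ?s ?s (e', e) \<in> twisted_stab G H H \<tau>})
       / real (card {\<tau> \<in> carrier G. map_prod ?s ?s (e', e) \<in> twisted_stab G H H \<tau>})
      = real (card {\<tau> \<in> bijections ?K ?K. intertwines p {..<k} \<tau> e' e \<and> 2 * k - card (matched p {..<k} \<tau>) = b})
      / real (card {\<tau> \<in> bijections ?K ?K. intertwines p {..<k} \<tau> e' e})"
      using cards[OF z, of "\<lambda>m. 2 * k - m = b"] cards[OF z, of "\<lambda>_. True"]
      by (simp add: B_def conj_assoc)
  qed
  also have "\<dots> = (\<Sum>y\<le>k. real (match_number \<sigma> choose y) * (real p - 1) ^ y * block_ratio p k b y)"
    using \<kappa>.sum_fixed_ratio[of k "\<lambda>m. 2 * k - m = b"]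
    by (simp add: match_number_def block_ratio_def)
  finally show ?thesis
    using lumped_kernel_eq[OF p k_less exp(2) b] by (simp add: exp(1) card_twisted_stab[OF \<sigma>])
qed

text \<open>Multiplied by \<open>p ^ a\<close>, the counts for this \<open>H\<close> and for the
  chosen Sylow subgroup both number the same block bijections.\<close>

lemma card_double_cosets_eq_count:
  "card {D \<in> double_cosets G H. card D = p ^ a} = sylow_double_coset_count p a k"
proof -
  have "p ^ a * card {D \<in> double_cosets G H. card D = p ^ a} = p ^ a * sylow_double_coset_count p a k"
    by (simp only: card_double_cosets_exponent sylow_double_coset_count[OF p k_less])
  then show ?thesis using p0 by simp
qed

lemma sum_sylow_double_coset_count:
  "(\<Sum>a = k..2 * k. sylow_double_coset_count p a k) = card (double_cosets G H)"
proof -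
  have fin: "finite (double_cosets G H)" by (simp add: double_cosets_def finite_sym_group)
  have "double_cosets G H = (\<Union>a\<in>{k..2 * k}. {D \<in> double_cosets G H. card D = p ^ a})"
  proof (intro equalityI subsetI)
    fix D assume D: "D \<in> double_cosets G H"
    then obtain \<sigma> where "\<sigma> \<in> carrier G" "D = double_coset G H \<sigma>" by (auto simp: double_cosets_def)
    then have "card D = p ^ (2 * k - match_number \<sigma>)" by (simp add: card_double_coset)
    moreover have "2 * k - match_number \<sigma> \<in> {k..2 * k}" using match_number_le[of \<sigma>] by auto
    ultimately show "D \<in> (\<Union>a\<in>{k..2 * k}. {D \<in> double_cosets G H. card D = p ^ a})" using D by blast
  qed auto
  then have "card (double_cosets G H) = card (\<Union>a\<in>{k..2 * k}. {D \<in> double_cosets G H. card D = p ^ a})"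
    by simp
  also have "\<dots> = (\<Sum>a = k..2 * k. card {D \<in> double_cosets G H. card D = p ^ a})"
    using fin p_gt_1 by (intro card_UN_disjoint) auto
  finally show ?thesis by (simp add: card_double_cosets_eq_count)
qed

end

theorem theorem1p6:
  fixes p k :: nat and H :: "(nat \<Rightarrow> nat) set"
  assumes "prime p" and "1 \<le> k" and "k < p"
    and "sylow_subgroup p H (sym_group (p * k))"
  shows
    "let G = sym_group (p * k);
         S = carrier G;
         P = burnside_kernel G H;
         T = double_coset_exponent p G H;
         f = (\<lambda>a j. real (sylow_double_coset_count p a j));
         Q = (\<lambda>a b. \<Sum>y = 0..2 * k - max a b.
               real ((2 * k - a) choose y) * ((real p - 1) / real p) ^ y
               * (real p ^ (a + b - 2 * k) / fact (p * (k - y))) * f (b - y) (k - y));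
         Z = (\<Sum>a = k..2 * k. f a k)
     in (\<forall>\<sigma>\<in>S. T \<sigma> \<in> {k..2 * k} \<and> (\<forall>a. T \<sigma> = a \<longleftrightarrow> card (double_coset G H \<sigma>) = p ^ a))
      \<and> lumps TYPE('w) S P T {k..2 * k}
      \<and> is_lumped_kernel TYPE('w) S P T {k..2 * k} Q
      \<and> (\<forall>\<sigma>\<in>S. \<forall>b\<in>{k..2 * k}. fibre_mass S T (P \<sigma>) b = Q (T \<sigma>) b)
      \<and> Z = real (card (double_cosets G H))
      \<and> stationary_distribution S P (\<lambda>\<sigma>. 1 / (Z * real (card (double_coset G H \<sigma>))))
      \<and> (\<forall>\<pi>. stationary_distribution S P \<pi> \<longrightarrow>
             (\<forall>a\<in>{k..2 * k}. fibre_mass S T \<pi> a = f a k / Z))"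
proof -
  obtain \<phi> where coord: "bij_betw \<phi> ({..<k} \<times> {..<p}) {1..p * k}" and H: "H = shift_group p k \<phi>"
    using sylow_coordinates[OF assms(1,3,4)] by metis
  interpret sylow_blocks p k \<phi> using assms(1,3) coord by unfold_locales
  define P where "P = burnside_kernel G H"
  define T where "T = double_coset_exponent p G H"
  define Z where "Z = real (card (double_cosets G H))"
  define \<mu> where "\<mu> \<sigma> = 1 / (Z * real (card (double_coset G H \<sigma>)))" for \<sigma>
  have fin: "finite (carrier G)" by (rule finite_sym_group)
  have sub: "subgroup H G" using subgroup_H by (simp only: H)
  have T: "T \<sigma> \<in> {k..2 * k}" "T \<sigma> = a \<longleftrightarrow> card (double_coset G H \<sigma>) = p ^ a"
    if "\<sigma> \<in> carrier G" for \<sigma> a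
    using double_coset_exponent_eq[OF that] card_double_coset_eq_iff[OF that] match_number_le[of \<sigma>]
    by (auto simp: T_def H)
  have fib: "fibre_mass (carrier G) T (P \<sigma>) b = lumped_kernel p k (T \<sigma>) b"
    if "\<sigma> \<in> carrier G" "b \<in> {k..2 * k}" for \<sigma> b
    using fibre_mass_burnside_kernel[OF that] by (simp only: P_def T_def H)
  have ker: "transition_kernel {k..2 * k} (lumped_kernel p k)"
    by (rule transition_kernel_lumped_kernel[OF assms(1,3)])
  have pos: "0 < P \<sigma> \<tau>" if "\<sigma> \<in> carrier G" "\<tau> \<in> carrier G" for \<sigma> \<tau>
    unfolding P_def using that by (intro G.burnside_kernel_pos fin sub)
  have trP: "transition_kernel (carrier G) P"
    unfolding transition_kernel_def
    using pos G.burnside_kernel_row_sum[OF fin sub] by (auto simp: P_def less_imp_le)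
  have T_range: "T \<in> carrier G \<rightarrow> {k..2 * k}" using T(1) by auto
  have lumped: "markov_chain M {k..2 * k} (lumped_kernel p k) (\<lambda>t \<omega>. T (X t \<omega>))"
    if "markov_chain M (carrier G) P X" for M :: "'w measure" and X
    by (rule fibre_mass_lumps[OF that fin T_range ker fib])
  have "double_coset G H \<one>\<^bsub>G\<^esub> \<in> double_cosets G H" by (simp add: double_cosets_def)
  then have Z0: "Z > 0" unfolding Z_def using fin by (auto simp: card_gt_0_iff double_cosets_def)
  have card_pos: "0 < real (card (double_coset G H \<sigma>))" if "\<sigma> \<in> carrier G" for \<sigma>
    using T(2)[OF that, of "T \<sigma>"] p0 by simp
  have \<mu>_pos: "0 < \<mu> \<sigma>" if "\<sigma> \<in> carrier G" for \<sigma>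
    using card_pos[OF that] Z0 by (simp add: \<mu>_def)
  have rev: "\<mu> \<sigma> * P \<sigma> \<tau> = \<mu> \<tau> * P \<tau> \<sigma>" if "\<sigma> \<in> carrier G" "\<tau> \<in> carrier G" for \<sigma> \<tau>
    using arg_cong[OF G.burnside_kernel_reversible[OF fin sub that], of "\<lambda>x. x / Z"]
    by (simp add: \<mu>_def P_def mult.commute)
  have "sum \<mu> (carrier G) = (\<Sum>D\<in>double_cosets G H. real (card D) * (1 / (Z * real (card D))))"
    unfolding \<mu>_def by (rule G.sum_over_double_cosets[OF fin sub])
  \<comment> \<open>Under \<open>\<mu>\<close> each double coset carries mass \<open>1 / Z\<close>,
    whatever its size.\<close>
  also have "\<dots> = (\<Sum>D\<in>double_cosets G H. 1 / Z)"
  proof (rule sum.cong[OF refl])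
    fix D assume "D \<in> double_cosets G H"
    then have "real (card D) > 0" using card_pos unfolding double_cosets_def by blast
    then show "real (card D) * (1 / (Z * real (card D))) = 1 / Z" by simp
  qed
  also have "\<dots> = 1" using Z0 by (simp add: Z_def)
  finally have \<mu>_sum: "sum \<mu> (carrier G) = 1" .
  have stat: "stationary_distribution (carrier G) P \<mu>"
    using reversible_stationary_distribution[OF fin trP rev _ \<mu>_sum] \<mu>_pos by (simp add: less_imp_le)
  have mass: "fibre_mass (carrier G) T \<pi> a = real (sylow_double_coset_count p a k) / Z"
    if \<pi>: "stationary_distribution (carrier G) P \<pi>" for \<pi> a
  proof -
    \<comment> \<open>By uniqueness \<open>\<pi>\<close> agrees with \<open>\<mu>\<close>, which is
      constant on the fibre over \<open>a\<close>. The fibre consists of \<open>f(a;k)\<close>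
      double cosets with \<open>p ^ a\<close> elements each, so \<open>p ^ a\<close>
      cancels.\<close>
    have "fibre_mass (carrier G) T \<pi> a = (\<Sum>\<sigma>\<in>{\<sigma> \<in> carrier G. T \<sigma> = a}. 1 / (Z * real p ^ a))"
      unfolding fibre_mass_def
    proof (rule sum.cong[OF refl])
      fix \<sigma> assume \<sigma>: "\<sigma> \<in> {\<sigma> \<in> carrier G. T \<sigma> = a}"
      then have "\<pi> \<sigma> = \<mu> \<sigma>"
        using stationary_distribution_unique[OF fin trP pos rev \<mu>_pos \<mu>_sum \<pi>] by blast
      then show "\<pi> \<sigma> = 1 / (Z * real p ^ a)" using \<sigma> T(2)[of \<sigma> a] by (simp add: \<mu>_def)
    qed
    also have "\<dots> = real (card {\<sigma> \<in> carrier G. T \<sigma> = a}) / (Z * real p ^ a)" by simp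
    also have "{\<sigma> \<in> carrier G. T \<sigma> = a} = {\<sigma> \<in> carrier G. 2 * k - match_number \<sigma> = a}"
      using double_coset_exponent_eq by (auto simp: T_def H)
    also have "card \<dots> = p ^ a * sylow_double_coset_count p a k"
      using sylow_double_coset_count[OF assms(1,3)] by (simp add: card_double_coset_exponent)
    finally show ?thesis using p0 by simp
  qed
  have Z: "(\<Sum>a = k..2 * k. real (sylow_double_coset_count p a k)) = Z"
    unfolding Z_def H sum_sylow_double_coset_count[symmetric] by simp
  have lumps: "lumps TYPE('w) (carrier G) P T {k..2 * k}"
    unfolding lumps_def using trP T_range lumped by blast
  have is_lumped: "is_lumped_kernel TYPE('w) (carrier G) P T {k..2 * k} (lumped_kernel p k)"
    unfolding is_lumped_kernel_def using ker lumped by blast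
  show ?thesis
    unfolding Let_def lumped_kernel_def[symmetric] Z P_def[symmetric] T_def[symmetric] \<mu>_def[symmetric]
    by (intro conjI ballI allI impI T lumps is_lumped fib stat mass Z_def)
qed

end
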